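(* Let $p$ be a prime, let $G$ be an abelian group which is a direct sum of cyclic $p$-groups, and let $U\subseteq G$ be a subgroup with $pU=0$. Then $(G,U)$ is isomorphic to a direct sum of pickets each of type $P^n_0=(\mathbb Z/(p^n),0)$ or $P^n_1=(\mathbb Z/(p^n),p^{n-1}\mathbb Z/(p^n))$ for some $n\ge1$ if and only if the factor group $G/U$ is a direct sum of cyclic $p$-groups. In this case, the direct sum decomposition is unique up to reordering and isomorphism of the summands.
   Context: A pair $(G,U)$ consists of an abelian group $G$ and a subgroup $U\subseteq G$. A morphism of pairs $(G,U)\to(G',U')$ is a group homomorphism $f:G\to G'$ with $f(U)\subseteq U'$; isomorphisms of pairs are the invertible such morphisms. The direct sum of pairs $(G_i,U_i)_{i\in I}$ is $(\bigoplus_i G_i,\bigoplus_i U_i)$. A picket is a pair $(G,U)$ in which $G$ is a cyclic $p$-group. *)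

theory Defs
  imports "HOL-Algebra.Algebra"
begin

definition pair_iso :: "('a,'b) monoid_scheme \<Rightarrow> 'a set \<Rightarrow> ('c,'d) monoid_scheme \<Rightarrow> 'c set \<Rightarrow> bool"
  where "pair_iso G U H V \<longleftrightarrow> (\<exists>h \<in> iso G H. h ` U = V)"

definition dsum_cyclic_p :: "'i itself \<Rightarrow> nat \<Rightarrow> ('a,'b) monoid_scheme \<Rightarrow> bool"
  where "dsum_cyclic_p _ p G \<longleftrightarrow>
     (\<exists>(I::'i set) (n::'i \<Rightarrow> nat). G \<cong> sum_group I (\<lambda>i. integer_mod_group (p ^ n i)))"

text \<open>Picket subgroups of Z/(p^n): type False is P^n_0 = (Z/(p^n), 0),
  type True is P^n_1 = (Z/(p^n), p^(n-1) Z/(p^n)).\<close>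
definition picket_sub :: "nat \<Rightarrow> nat \<Rightarrow> bool \<Rightarrow> int set"
  where "picket_sub p n t = (if t then {int (p ^ (n - 1)) * k | k. 0 \<le> k \<and> k < int p} else {0})"

definition picket_sum_group :: "nat \<Rightarrow> 'i set \<Rightarrow> ('i \<Rightarrow> nat) \<Rightarrow> ('i \<Rightarrow> int) monoid"
  where "picket_sum_group p I n = sum_group I (\<lambda>i. integer_mod_group (p ^ n i))"

definition picket_sum_sub :: "nat \<Rightarrow> 'i set \<Rightarrow> ('i \<Rightarrow> nat) \<Rightarrow> ('i \<Rightarrow> bool) \<Rightarrow> ('i \<Rightarrow> int) set"
  where "picket_sum_sub p I n t =
     {x \<in> carrier (picket_sum_group p I n). \<forall>i\<in>I. x i \<in> picket_sub p (n i) (t i)}"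

end

theory Submission
  imports Defs
begin

text \<open>
  Write \<open>S\<close> for the elements of \<open>G\<close> killed by \<open>p\<close> and \<open>V\<^sub>n = S \<inter> p\<^sup>n G\<close>. It suffices to find a basis \<open>B\<close> of
  \<open>S\<close> such that \<open>B \<inter> U\<close> spans \<open>U\<close> and the height of a linear combination is the least height occurring
  in it: choosing for each \<open>b \<in> B\<close> of height \<open>n\<close> some \<open>g\<close> with \<open>p\<^sup>n g = b\<close> then splits \<open>G\<close> into
  pickets. As \<open>G\<close> and \<open>G/U\<close> are direct sums of cyclic groups, each is the union of an ascending chain
  of subgroups whose \<open>k\<close>-th member contains no nonzero \<open>p\<^sup>k x\<close>; let \<open>F\<close> be the chain of \<open>G\<close> and \<open>F'\<close>
  the preimage of the chain of \<open>G/U\<close>. Well-order \<open>G\<close> so that \<open>U\<close> comes first, by the stage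
  in \<open>F\<close>, followed by the other elements by their stage in \<open>F'\<close>. The elements of \<open>V\<^sub>n\<close> that are not in
  the span of \<open>V\<^sub>n\<^sub>+\<^sub>1\<close> and their predecessors in \<open>V\<^sub>n\<close> are the elements of \<open>B\<close> of height \<open>n\<close>.

  Conversely, a quotient of pickets is a sum of cyclic groups. For uniqueness, the number of summands
  \<open>P\<^sup>n\<^sub>1\<close> is the rank of \<open>(U \<inter> V\<^sub>n\<^sub>-\<^sub>1) / (U \<inter> V\<^sub>n)\<close>, and that of summands \<open>P\<^sup>n\<^sub>0\<close> is the rank of
  \<open>V\<^sub>n\<^sub>-\<^sub>1 / (V\<^sub>n + (U \<inter> V\<^sub>n\<^sub>-\<^sub>1))\<close>.
\<close>

section \<open>Sums of cyclic groups and pickets\<close>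

lemma group_picket_sum_group [simp]: "group (picket_sum_group p I n)"
  by (simp add: picket_sum_group_def)

lemma one_picket_sum_group: "\<one>\<^bsub>picket_sum_group p I n\<^esub> = (\<lambda>i\<in>I. 0)"
  by (simp add: picket_sum_group_def)

lemma mult_picket_sum_group:
  "x \<otimes>\<^bsub>picket_sum_group p I n\<^esub> y = (\<lambda>i\<in>I. (x i + y i) mod int (p ^ n i))"
  by (simp add: picket_sum_group_def)

lemma carrier_picket_sum_group:
  assumes "p > 0"
  shows "x \<in> carrier (picket_sum_group p I n) \<longleftrightarrow>
    x \<in> extensional I \<and> (\<forall>i\<in>I. 0 \<le> x i \<and> x i < int (p ^ n i)) \<and> finite {i\<in>I. x i \<noteq> 0}"
  using assms
  by (auto simp: picket_sum_group_def carrier_sum_group carrier_integer_mod_group PiE_iff)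

lemma inv_picket_sum_group:
  "x \<in> carrier (picket_sum_group p I n) \<Longrightarrow>
    inv\<^bsub>picket_sum_group p I n\<^esub> x = (\<lambda>i\<in>I. (- x i) mod int (p ^ n i))"
  by (auto simp: picket_sum_group_def carrier_sum_group PiE_iff intro!: restrict_ext)

lemma pow_picket_sum_group:
  fixes k :: nat
  shows "x [^]\<^bsub>picket_sum_group p I n\<^esub> k = (\<lambda>i\<in>I. (int k * x i) mod int (p ^ n i))"
  by (induction k)
     (auto simp: one_picket_sum_group mult_picket_sum_group mod_simps algebra_simps restrict_def fun_eq_iff)

lemma pair_iso_sym:
  assumes "group G" "U \<subseteq> carrier G" "pair_iso G U H V"
  shows "pair_iso H V G U"
proof -
  obtain h where h: "h \<in> iso G H" "h ` U = V" using assms(3) by (auto simp: pair_iso_def)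
  then have "inv_into (carrier G) h ` V = U"
    using assms(2) by (auto simp: iso_def bij_betw_def image_image inv_into_f_f subset_iff image_iff)
  then show ?thesis
    using group.iso_set_sym[OF assms(1) h(1)] by (auto simp: pair_iso_def)
qed

text \<open>For reduced representatives the list of multiples becomes a divisibility condition:
  \<open>p ^ n\<close> is \<open>p ^ (n - 1)\<close> times \<open>p\<close>, so the cofactor of a
  multiple lies in \<open>[0, p)\<close>.\<close>

lemma mem_picket_sub:
  assumes "p > 0" "n \<ge> 1" "0 \<le> x" "x < int (p ^ n)"
  shows "x \<in> picket_sub p n t \<longleftrightarrow> (if t then int (p ^ (n - 1)) dvd x else x = 0)"
proof -
  have "\<exists>k. x = int (p ^ (n - 1)) * k \<and> 0 \<le> k \<and> k < int p" if "int (p ^ (n - 1)) dvd x"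
  proof -
    from that obtain k where k: "x = int (p ^ (n - 1)) * k" by (rule dvdE)
    have "int (p ^ n) = int (p ^ (n - 1)) * int p"
      using assms(2) by (cases n) (simp_all add: mult.commute)
    then have "k < int p" "0 \<le> k"
      using assms k by (simp_all add: zero_le_mult_iff not_le flip: of_nat_power)
    with k show ?thesis by blast
  qed
  then show ?thesis by (auto simp: picket_sub_def)
qed

lemma subgroup_picket_sum_sub:
  assumes "p > 0" "\<And>i. i \<in> I \<Longrightarrow> n i \<ge> 1"
  shows "subgroup (picket_sum_sub p I n t) (picket_sum_group p I n)"
proof -
  let ?P = "picket_sum_group p I n"
  have mem: "x \<in> picket_sum_sub p I n t \<longleftrightarrow> x \<in> carrier ?P \<and>
     (\<forall>i\<in>I. if t i then int (p ^ (n i - 1)) dvd x i else x i = 0)" for x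
    using assms by (auto simp: picket_sum_sub_def carrier_picket_sum_group mem_picket_sub)
  have d: "int (p ^ (n i - 1)) dvd int (p ^ n i)" for i
    by (simp add: le_imp_power_dvd)
  show ?thesis
  proof (rule group.subgroupI)
    have "\<one>\<^bsub>?P\<^esub> \<in> picket_sum_sub p I n t"
      using monoid.one_closed[OF group.is_monoid[OF group_picket_sum_group, of p I n]]
      unfolding mem by (auto simp: one_picket_sum_group)
    then show "picket_sum_sub p I n t \<noteq> {}" by blast
  next
    show "inv\<^bsub>?P\<^esub> x \<in> picket_sum_sub p I n t" if "x \<in> picket_sum_sub p I n t" for x
      using that group.inv_closed[OF group_picket_sum_group, of x p I n] d
      unfolding mem by (auto simp: inv_picket_sum_group intro!: dvd_mod)
  next
    show "x \<otimes>\<^bsub>?P\<^esub> y \<in> picket_sum_sub p I n t"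
      if "x \<in> picket_sum_sub p I n t" "y \<in> picket_sum_sub p I n t" for x y
      using that monoid.m_closed[OF group.is_monoid[OF group_picket_sum_group], of x p I n y] d
      unfolding mem by (auto simp: mult_picket_sum_group intro!: dvd_mod dvd_add)
  qed (auto simp: mem)
qed

text \<open>In an abelian group the product set of two subgroups is again a subgroup, and it
  contains both \<open>H\<close> and \<open>S\<close>. It serves to split off a deeper layer of the
  socle.\<close>

lemma (in comm_group) generate_Un_decompose:
  assumes H: "subgroup H G" and S: "S \<subseteq> carrier G" and x: "x \<in> generate G (H \<union> S)"
  shows "\<exists>h\<in>H. \<exists>w\<in>generate G S. x = h \<otimes> w"
proof -
  have sS: "subgroup (generate G S) G" using S by (rule generate_is_subgroup)
  have "subgroup (H <#> generate G S) G"
    using mult_subgroups[OF H sS] .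
  moreover have "H \<union> S \<subseteq> H <#> generate G S"
  proof
    fix y assume "y \<in> H \<union> S"
    then show "y \<in> H <#> generate G S"
    proof
      assume "y \<in> H"
      then have "y = y \<otimes> \<one>" using subgroup.subset[OF H] by auto
      then show ?thesis using \<open>y \<in> H\<close> subgroup.one_closed[OF sS] unfolding set_mult_def by blast
    next
      assume "y \<in> S"
      then have "y = \<one> \<otimes> y" "y \<in> generate G S" using S by (auto intro: generate.incl)
      then show ?thesis using subgroup.one_closed[OF H] unfolding set_mult_def by blast
    qed
  qed
  ultimately have "x \<in> H <#> generate G S"
    using generate_subgroup_incl[of "H \<union> S" "H <#> generate G S"] x by blast
  then show ?thesis by (auto simp: set_mult_def)
qed

lemma (in comm_group) finprod_in_subgroup:
  assumes "subgroup H G" "\<And>x. x \<in> A \<Longrightarrow> f x \<in> H"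
  shows "finprod G f A \<in> H"
  using assms(2)
proof (induction A rule: infinite_finite_induct)
  case (insert a A)
  have "f \<in> A \<rightarrow> carrier G" "f a \<in> carrier G"
    using insert.prems subgroup.subset[OF assms(1)] by auto
  then show ?case using insert by (simp add: subgroup.m_closed[OF assms(1)])
qed (auto simp: subgroup.one_closed[OF assms(1)])

text \<open>This is what makes exponentiation of a generator well defined on residues, hence a
  homomorphism from \<open>integer_mod_group\<close>.\<close>

lemma (in group) int_pow_mod:
  assumes "g \<in> carrier G" "g [^] N = \<one>"
  shows "g [^] (k mod int N) = g [^] k"
proof -
  have "g [^] k = g [^] (int N * (k div int N) + k mod int N)" by simp
  also have "\<dots> = (g [^] int N) [^] (k div int N) \<otimes> g [^] (k mod int N)"
    using assms by (simp only: int_pow_mult int_pow_pow)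
  finally show ?thesis using assms by (simp add: int_pow_int)
qed

lemma (in comm_group) pow_hom: "group_hom G G (\<lambda>x. x [^] (k::nat))"
  by (auto intro!: group_hom.intro group_hom_axioms.intro homI simp: nat_pow_distrib)

section \<open>Chains of subgroups of bounded height\<close>

text \<open>The chain of Kulikov's criterion, relative to \<open>K\<close>: for a subgroup
  \<open>K\<close> the stages modulo \<open>K\<close> contain no nontrivial \<open>p ^ k\<close>-th
  power at index \<open>k\<close>. Working with preimages in \<open>G\<close> avoids computing with
  cosets.\<close>

definition height_chain :: "nat \<Rightarrow> ('a,'b) monoid_scheme \<Rightarrow> 'a set \<Rightarrow> (nat \<Rightarrow> 'a set) \<Rightarrow> bool"
  where "height_chain p G K F \<longleftrightarrow>
    (\<forall>k. subgroup (F k) G \<and> K \<subseteq> F k) \<and> mono F \<and> (\<Union>k. F k) = carrier G \<and>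
    (\<forall>k. \<forall>x\<in>carrier G. x [^]\<^bsub>G\<^esub> (p ^ k) \<in> F k \<longrightarrow> x [^]\<^bsub>G\<^esub> (p ^ k) \<in> K)"

lemma
  assumes "height_chain p G K F"
  shows height_chain_subgroup: "subgroup (F k) G"
    and height_chain_subset: "K \<subseteq> F k"
    and height_chain_mono: "i \<le> j \<Longrightarrow> F i \<subseteq> F j"
    and height_chain_exhaust: "x \<in> carrier G \<Longrightarrow> \<exists>k. x \<in> F k"
    and height_chain_pow: "x \<in> carrier G \<Longrightarrow> x [^]\<^bsub>G\<^esub> (p ^ k) \<in> F k \<Longrightarrow> x [^]\<^bsub>G\<^esub> (p ^ k) \<in> K"
  using assms monoD[of F i j] by (simp_all add: height_chain_def set_eq_iff)

text \<open>Stage \<open>k\<close> consists of the vectors vanishing on all summands with exponent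
  above \<open>k\<close>. A \<open>p ^ k\<close>-th power vanishes on the remaining summands, whose
  order divides \<open>p ^ k\<close>.\<close>

lemma height_chain_picket_sum:
  fixes I :: "'i set" and n :: "'i \<Rightarrow> nat"
  assumes "p > 0"
  defines "P \<equiv> picket_sum_group p I n"
  shows "height_chain p P {\<one>\<^bsub>P\<^esub>} (\<lambda>k. {x \<in> carrier P. \<forall>i\<in>I. k < n i \<longrightarrow> x i = 0})"
proof -
  let ?F = "\<lambda>k. {x \<in> carrier P. \<forall>i\<in>I. k < n i \<longrightarrow> x i = 0}"
  have grp: "group P" by (simp add: P_def)
  have "subgroup (?F k) P" for k
  proof (rule group.subgroupI[OF grp])
    have "\<one>\<^bsub>P\<^esub> \<in> ?F k"
      using monoid.one_closed[OF group.is_monoid[OF grp]] by (auto simp: P_def one_picket_sum_group)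
    then show "?F k \<noteq> {}" by blast
  qed (auto simp: group.inv_closed[OF grp] monoid.m_closed[OF group.is_monoid[OF grp]],
       auto simp: P_def inv_picket_sum_group mult_picket_sum_group)
  moreover have "{\<one>\<^bsub>P\<^esub>} \<subseteq> ?F k" for k
    using monoid.one_closed[OF group.is_monoid[OF grp]] by (auto simp: P_def one_picket_sum_group)
  moreover have "mono ?F" by (auto simp: mono_def)
  moreover have "x \<in> (\<Union>k. ?F k)" if "x \<in> carrier P" for x
  proof -
    have fin: "finite (n ` {i\<in>I. x i \<noteq> 0})"
      using that assms by (auto simp: P_def carrier_picket_sum_group)
    have "n i \<le> Max (n ` {i\<in>I. x i \<noteq> 0})" if "i \<in> I" "x i \<noteq> 0" for i
      using Max_ge[OF fin] that by auto
    \<comment> \<open>The largest exponent in the support is a stage containing \<open>x\<close>.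
      For empty support every stage contains it, whatever value \<open>Max\<close> has
      there.\<close>
    then have "x \<in> ?F (Max (n ` {i\<in>I. x i \<noteq> 0}))"
      using that by (auto simp: not_less[symmetric])
    then show ?thesis by blast
  qed
  moreover have "x [^]\<^bsub>P\<^esub> (p ^ k) = \<one>\<^bsub>P\<^esub>" if "x \<in> carrier P" "x [^]\<^bsub>P\<^esub> (p ^ k) \<in> ?F k" for x k
  proof -
    have "(int (p ^ k) * x i) mod int (p ^ n i) = 0" if i: "i \<in> I" for i
    proof (cases "k < n i")
      case True
      then show ?thesis using \<open>x [^]\<^bsub>P\<^esub> (p ^ k) \<in> ?F k\<close> i by (auto simp: P_def pow_picket_sum_group)
    next
      case False
      then have "p ^ n i dvd p ^ k" by (simp add: le_imp_power_dvd)
      then have "int (p ^ n i) dvd int (p ^ k)" using int_dvd_int_iff by blast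
      then show ?thesis by (metis dvd_imp_mod_0 dvd_mult2)
    qed
    then show ?thesis by (auto simp: P_def pow_picket_sum_group one_picket_sum_group intro!: restrict_ext)
  qed
  ultimately show ?thesis
    unfolding height_chain_def by (auto 0 0)
qed

text \<open>Homomorphisms commute with powers, so a \<open>p ^ k\<close>-th power in the preimage of
  stage \<open>k\<close> has trivial image and thus lies in the kernel.\<close>

lemma height_chain_vimage:
  assumes f: "group_hom G H f" and F: "height_chain p H {\<one>\<^bsub>H\<^esub>} F"
  shows "height_chain p G (kernel G H f) (\<lambda>k. {x \<in> carrier G. f x \<in> F k})"
proof -
  interpret group_hom G H f by fact
  have sub: "subgroup (F k) H" for k using F by (auto simp: height_chain_def)
  have "subgroup {x \<in> carrier G. f x \<in> F k} G" for k
    by (rule G.subgroupI)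
       (use sub[of k] subgroup.one_closed[OF sub[of k]] in
         \<open>auto simp: subgroup.m_inv_closed subgroup.m_closed intro!: exI[of _ "\<one>\<^bsub>G\<^esub>"]\<close>)
  then show ?thesis
    using F subgroup.one_closed[OF sub]
    unfolding height_chain_def kernel_def mono_def set_eq_iff
    by (auto 0 0 simp: hom_nat_pow subset_iff)
qed

text \<open>Stated for a homomorphism so as to serve twice: the identity yields the chain
  \<open>F\<close> of \<open>G\<close>, the projection to \<open>G Mod U\<close> the chain
  \<open>F'\<close> relative to \<open>U\<close>.\<close>

lemma dsum_cyclic_p_height_chain:
  assumes "p > 0" "group_hom G H f" "dsum_cyclic_p TYPE('i) p H"
  shows "\<exists>F. height_chain p G (kernel G H f) F"
proof -
  interpret group_hom G H f by fact
  obtain I :: "'i set" and n h where h: "h \<in> iso H (picket_sum_group p I n)"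
    using assms(3) by (auto simp: dsum_cyclic_p_def is_iso_def picket_sum_group_def)
  let ?P = "picket_sum_group p I n"
  interpret h: group_hom H ?P h
    using h by (auto intro!: group_hom.intro group_hom_axioms.intro simp: iso_def)
  interpret hf: group_hom G ?P "h \<circ> f"
    using Group.hom_compose[OF homh h.homh] by (auto intro!: group_hom.intro group_hom_axioms.intro)
  have "kernel G ?P (h \<circ> f) = kernel G H f"
    using h inj_on_eq_iff[of h "carrier H" _ "\<one>\<^bsub>H\<^esub>"]
    by (auto simp: kernel_def iso_def bij_betw_def simp flip: h.hom_one)
  then show ?thesis
    using height_chain_vimage[OF hf.group_hom_axioms height_chain_picket_sum[OF assms(1)]] by auto
qed

section \<open>A basis of the socle adapted to the subgroup\<close>

text \<open>The groups \<open>V\<^sub>n\<close> of the outline, in multiplicative notation.\<close>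

definition height_socle :: "nat \<Rightarrow> ('a,'b) monoid_scheme \<Rightarrow> nat \<Rightarrow> 'a set"
  where "height_socle p G n = {x \<in> carrier G. x [^]\<^bsub>G\<^esub> p = \<one>\<^bsub>G\<^esub> \<and>
    (\<exists>g\<in>carrier G. x = g [^]\<^bsub>G\<^esub> (p ^ n))}"

locale height_chain_pair = comm_group G for G :: "('a,'b) monoid_scheme" (structure) +
  fixes p :: nat and U :: "'a set" and F F' :: "nat \<Rightarrow> 'a set"
  assumes prime: "Factorial_Ring.prime p"
    and U: "subgroup U G" "\<And>u. u \<in> U \<Longrightarrow> u [^] p = \<one>"
    and F: "height_chain p G {\<one>} F"
    and F': "height_chain p G U F'"
begin

abbreviation socle :: "nat \<Rightarrow> 'a set"
  where "socle n \<equiv> height_socle p G n"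

text \<open>The first coordinate puts \<open>U\<close> first, the second compares first stages, and
  an arbitrary well-order, made strict by removing the diagonal, breaks ties and so makes the
  relation total.\<close>

definition prec :: "('a \<times> 'a) set"
  where "prec = inv_image (less_than <*lex*> less_than <*lex*> ((SOME r. well_order_on UNIV r) - Id))
     (\<lambda>x. (if x \<in> U then 0 else 1, LEAST k. x \<in> (if x \<in> U then F k else F' k), x))"

text \<open>Comparing \<open>x\<close> with all its predecessors in the layer, instead of only those
  already chosen, expresses the greedy choice without recursion.\<close>

definition basis :: "nat \<Rightarrow> 'a set"
  where "basis n = {x \<in> socle n. x \<notin> generate G (socle (Suc n) \<union> {y \<in> socle n. (y, x) \<in> prec})}"

text \<open>An induction along \<open>prec\<close> that starts in such a set stays in it, so its
  elements can be generated by basis elements from the same set.\<close>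

definition prec_closed :: "'a set \<Rightarrow> bool"
  where "prec_closed T \<longleftrightarrow> (\<forall>x\<in>T. \<forall>y\<in>carrier G. (y, x) \<in> prec \<longrightarrow> y \<in> T)"

lemma p_pos: "p > 0" using prime prime_gt_0_nat by blast

lemma well_order_choice: "well_order_on UNIV (SOME r::('a \<times> 'a) set. well_order_on UNIV r)"
  by (rule someI_ex) (rule well_order_on)

lemma wf_prec: "wf prec"
  using well_order_choice unfolding prec_def well_order_on_def
  by (intro wf_inv_image wf_lex_prod wf_less_than) auto

lemma prec_total: "x \<noteq> y \<Longrightarrow> (x, y) \<in> prec \<or> (y, x) \<in> prec"
  using well_order_choice
  unfolding prec_def well_order_on_def linear_order_on_def total_on_def in_inv_image
  by (auto simp: less_than_def[symmetric])

text \<open>Since \<open>U\<close> comes first, a predecessor of an element of \<open>U\<close> lies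
  in \<open>U\<close>, and its first stage in \<open>F\<close> is no later.\<close>

lemma prec_closed_U_F: "prec_closed (U \<inter> F k)"
  unfolding prec_closed_def
proof (intro ballI impI)
  fix x y assume assms: "(y, x) \<in> prec" "x \<in> U \<inter> F k" "y \<in> carrier G"
  have y: "y \<in> U" using assms by (auto simp: prec_def split: if_splits)
  obtain j where "y \<in> F j" using height_chain_exhaust[OF F assms(3)] by blast
  then have 1: "y \<in> F (LEAST k. y \<in> F k)" by (rule LeastI)
  have "(LEAST k. x \<in> F k) \<le> k" using assms(2) by (auto intro: Least_le)
  moreover have "(LEAST k. y \<in> F k) \<le> (LEAST k. x \<in> F k)"
    using assms y by (auto simp: prec_def)
  ultimately have "F (LEAST k. y \<in> F k) \<subseteq> F k"
    using height_chain_mono[OF F] by (meson order_trans)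
  with 1 y show "y \<in> U \<inter> F k" by blast
qed

text \<open>Predecessors in \<open>U\<close> are harmless because every stage of \<open>F'\<close>
  contains \<open>U\<close>. A predecessor outside \<open>U\<close> forces \<open>x\<close> outside
  \<open>U\<close>, and then the stages in \<open>F'\<close> are compared.\<close>

lemma prec_closed_F': "prec_closed (F' k)"
  unfolding prec_closed_def
proof (intro ballI impI)
  fix x y assume assms: "(y, x) \<in> prec" "x \<in> F' k" "y \<in> carrier G"
  show "y \<in> F' k"
  proof (cases "y \<in> U")
    case True
    then show ?thesis using height_chain_subset[OF F'] by blast
  next
    case False
    then have x: "x \<notin> U" using assms by (auto simp: prec_def split: if_splits)
    obtain j where "y \<in> F' j" using height_chain_exhaust[OF F' assms(3)] by blast
    then have 1: "y \<in> F' (LEAST k. y \<in> F' k)" by (rule LeastI)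
    have "(LEAST k. x \<in> F' k) \<le> k" using assms(2) by (auto intro: Least_le)
    moreover have "(LEAST k. y \<in> F' k) \<le> (LEAST k. x \<in> F' k)"
      using assms x False by (auto simp: prec_def)
    ultimately have "F' (LEAST k. y \<in> F' k) \<subseteq> F' k"
      using height_chain_mono[OF F'] by (meson order_trans)
    with 1 show ?thesis by blast
  qed
qed

section \<open>The descending layers of the socle\<close>

lemma subgroup_socle: "subgroup (socle n) G"
proof (rule subgroupI)
  show "socle n \<noteq> {}" by (auto simp: height_socle_def intro!: exI[of _ \<one>] bexI[of _ \<one>])
  show "inv a \<in> socle n" if "a \<in> socle n" for a
  proof -
    from that obtain g where "g \<in> carrier G" "a = g [^] (p ^ n)" "a [^] p = \<one>"
      by (auto simp: height_socle_def)
    then have "inv a = (inv g) [^] (p ^ n)" "(inv a) [^] p = \<one>" "inv g \<in> carrier G"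
      by (simp_all add: nat_pow_inv)
    then show ?thesis unfolding height_socle_def by auto
  qed
  show "a \<otimes> b \<in> socle n" if "a \<in> socle n" "b \<in> socle n" for a b
  proof -
    from that obtain g h where "g \<in> carrier G" "h \<in> carrier G" "a = g [^] (p ^ n)" "b = h [^] (p ^ n)"
      by (auto simp: height_socle_def)
    then have "a \<otimes> b = (g \<otimes> h) [^] (p ^ n)" "g \<otimes> h \<in> carrier G"
      by (auto simp: nat_pow_distrib)
    moreover have "(a \<otimes> b) [^] p = \<one>" using that by (simp add: height_socle_def nat_pow_distrib)
    ultimately show ?thesis unfolding height_socle_def by auto
  qed
qed (auto simp: height_socle_def)

lemma socle_carrier: "socle n \<subseteq> carrier G"
  by (auto simp: height_socle_def)

lemma socle_antimono: "m \<le> n \<Longrightarrow> socle n \<subseteq> socle m"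
proof -
  assume "m \<le> n"
  then have "p ^ n = p ^ (n - m) * p ^ m" by (simp flip: power_add)
  then have *: "g [^] (p ^ n) = (g [^] (p ^ (n - m))) [^] (p ^ m)" if "g \<in> carrier G" for g
    using that by (simp add: nat_pow_pow)
  show ?thesis
  proof
    fix x assume "x \<in> socle n"
    then obtain g where "g \<in> carrier G" "x = g [^] (p ^ n)" "x \<in> carrier G" "x [^] p = \<one>"
      by (auto simp: height_socle_def)
    with * show "x \<in> socle m" unfolding height_socle_def by blast
  qed
qed

lemma socle_0: "socle 0 = {x \<in> carrier G. x [^] p = \<one>}"
  by (auto simp: height_socle_def)

section \<open>Independence of the basis\<close>

lemma basis_socle: "basis n \<subseteq> socle n"
  by (auto simp: basis_def)

text \<open>All elements of height above \<open>m\<close> are among the generators of the subgroup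
  that \<open>basis m\<close> avoids.\<close>

lemma basis_disjoint:
  assumes "b \<in> basis m" "b \<in> basis n" shows "m = n"
proof (rule ccontr)
  have *: False if "b \<in> basis m" "b \<in> basis n" "m < n" for m n
  proof -
    have "b \<in> socle (Suc m)"
      using that socle_antimono[of "Suc m" n] basis_socle[of n] by auto
    then show False using that(1) by (auto simp: basis_def intro: generate.incl)
  qed
  assume "m \<noteq> n"
  with * assms show False by (meson linorder_neqE_nat)
qed

text \<open>From a relation discard the factors with exponent divisible by \<open>p\<close>. Among
  the rest take the least height and, within it, the last element \<open>b\<close> for
  \<open>prec\<close>. All other factors lie in the subgroup that \<open>b\<close> must avoid by its
  choice, hence so does \<open>b\<close>, a contradiction.\<close>

lemma basis_independent:
  fixes c :: "'a \<Rightarrow> int"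
  assumes "finite S" "S \<subseteq> (\<Union>n. basis n)" and eq: "(\<Otimes>b\<in>S. b [^] c b) = \<one>" and "b \<in> S"
  shows "int p dvd c b"
proof (rule ccontr)
  define Y where "Y = {b\<in>S. \<not> int p dvd c b}"
  assume "\<not> int p dvd c b"
  then have Y: "Y \<noteq> {}" "finite Y" "Y \<subseteq> S" using assms by (auto simp: Y_def)
  have Sb: "b \<in> carrier G" "b [^] p = \<one>" if "b \<in> S" for b
    using that assms(2) basis_socle by (auto simp: height_socle_def)
  have triv: "b [^] c b = \<one>" if "b \<in> S - Y" for b
  proof -
    from that have "int p dvd c b" by (simp add: Y_def)
    then obtain d where "c b = int p * d" by (rule dvdE)
    then have "b [^] c b = (b [^] (int p)) [^] d" using Sb that by (simp add: int_pow_pow)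
    then show ?thesis using Sb that by (simp add: int_pow_int)
  qed
  have eqY: "(\<Otimes>b\<in>Y. b [^] c b) = \<one>"
    using finprod_mono_neutral_cong_left[OF assms(1) Y(3), of "\<lambda>b. b [^] c b" "\<lambda>b. b [^] c b"] triv Sb eq
    by auto
  define n where "n = (LEAST n. basis n \<inter> Y \<noteq> {})"
  have "\<exists>n. basis n \<inter> Y \<noteq> {}" using Y assms(2) by blast
  then have n: "basis n \<inter> Y \<noteq> {}" unfolding n_def by (rule LeastI_ex)
  have nmin: "n \<le> m" if "b \<in> basis m" "b \<in> Y" for b m
    unfolding n_def using that by (intro Least_le) auto
  \<comment> \<open>On the finite set \<open>Y\<close> the converse of \<open>prec\<close> is
    well-founded too, which provides a last element.\<close>
  let ?r = "prec \<inter> (Y \<times> Y)"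
  have "wf (?r\<inverse>)"
    using Y(2) by (intro finite_acyclic_wf_converse) (auto intro: wf_acyclic wf_subset[OF wf_prec])
  moreover obtain b' where "b' \<in> basis n \<inter> Y" using n by blast
  ultimately obtain b where b: "b \<in> basis n \<inter> Y" "\<And>y. (y, b) \<in> ?r\<inverse> \<Longrightarrow> y \<notin> basis n \<inter> Y"
    by (rule wfE_min) blast
  let ?E = "generate G (socle (Suc n) \<union> {y \<in> socle n. (y, b) \<in> prec})"
  have E: "subgroup ?E G"
    using socle_carrier by (intro generate_is_subgroup) blast
  have "y \<in> ?E" if y: "y \<in> Y" "y \<noteq> b" for y
  proof -
    obtain m where m: "y \<in> basis m" using y Y assms(2) by blast
    with nmin y have "n \<le> m" by blast
    show ?thesis
    proof (cases "m = n")
      case True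
      then have "(y, b) \<in> prec" using prec_total[OF y(2)] b y m by blast
      then show ?thesis using m True basis_socle by (intro generate.incl) blast
    next
      case False
      then have "y \<in> socle (Suc n)" using \<open>n \<le> m\<close> socle_antimono[of "Suc n" m] m basis_socle by auto
      then show ?thesis by (intro generate.incl) blast
    qed
  qed
  then have "y [^] c y \<in> ?E" if "y \<in> Y - {b}" for y
    using that subgroup_int_pow_closed[OF E] by blast
  then have rest: "(\<Otimes>y\<in>Y - {b}. y [^] c y) \<in> ?E"
    by (rule finprod_in_subgroup[OF E])
  have bc: "b \<in> carrier G" "b [^] p = \<one>" using b Y Sb by auto
  have "insert b (Y - {b}) = Y" using b by blast
  moreover have "(\<lambda>y. y [^] c y) \<in> Y - {b} \<rightarrow> carrier G" using Y Sb by blast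
  ultimately have "b [^] c b \<otimes> (\<Otimes>y\<in>Y - {b}. y [^] c y) = \<one>"
    using eqY finprod_insert[of "Y - {b}" b "\<lambda>y. y [^] c y"] Y(2) bc by simp
  then have "b [^] c b = inv (\<Otimes>y\<in>Y - {b}. y [^] c y)"
    using inv_equality subgroup.mem_carrier[OF E rest] bc by simp
  then have bcE: "b [^] c b \<in> ?E"
    using subgroup.m_inv_closed[OF E rest] by simp
  \<comment> \<open>The exponent is invertible modulo \<open>p\<close> and \<open>b\<close> is
    killed by \<open>p\<close>, so \<open>b\<close> is a power of \<open>b [^] c b\<close>.\<close>
  have "coprime (c b) (int p)"
    using b prime by (auto simp: Y_def coprime_commute intro!: prime_imp_coprime)
  then obtain u v where uv: "u * c b + v * int p = 1"
    using bezout_int[of "c b" "int p"] by (metis coprime_imp_gcd_eq_1)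
  have "b = b [^] (c b * u + int p * v)" using uv bc by (simp add: mult.commute)
  also have "\<dots> = (b [^] c b) [^] u \<otimes> (b [^] int p) [^] v"
    using bc by (simp add: int_pow_mult int_pow_pow)
  also have "\<dots> = (b [^] c b) [^] u" using bc by (simp add: int_pow_int)
  finally have "b \<in> ?E" using subgroup_int_pow_closed[OF E bcE, of u] by simp
  then show False using b by (auto simp: basis_def)
qed

text \<open>Well-founded induction: an element not chosen is generated by the next layer and its
  predecessors in the layer, which remain in \<open>T\<close> and are covered by the induction
  hypothesis.\<close>

lemma basis_spans_step:
  assumes T: "prec_closed T"
    and x: "x \<in> T" "x \<in> socle n"
  shows "x \<in> generate G (socle (Suc n) \<union> (basis n \<inter> T))" (is "_ \<in> ?E")
  using x
proof (induction x rule: wf_induct_rule[OF wf_prec])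
  case (1 x)
  show ?case
  proof (cases "x \<in> basis n")
    case True
    then show ?thesis using 1 by (auto intro: generate.incl)
  next
    case False
    have E: "subgroup ?E G"
      using socle_carrier basis_socle by (intro generate_is_subgroup) blast
    have "y \<in> ?E" if "y \<in> socle n" "(y, x) \<in> prec" for y
      using 1 T that socle_carrier[of n] unfolding prec_closed_def by blast
    then have "socle (Suc n) \<union> {y \<in> socle n. (y, x) \<in> prec} \<subseteq> ?E"
      by (auto intro: generate.incl)
    from generate_subgroup_incl[OF this E] show ?thesis
      using False 1 by (auto simp: basis_def)
  qed
qed

text \<open>Each round replaces what is left in \<open>T\<close> at one height by something in
  \<open>T\<close> one height deeper. The bound on heights in a stage of a chain will end the
  process.\<close>

lemma basis_spans_iterate:
  assumes T: "prec_closed T"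
    and sub: "subgroup T G"
  shows "T \<inter> socle n \<subseteq> generate G ((T \<inter> socle (n + m)) \<union> ((\<Union>i\<in>{n..}. basis i) \<inter> T))"
proof (induction m)
  case 0
  then show ?case by (auto intro: generate.incl)
next
  case (Suc m)
  let ?B = "(\<Union>i\<in>{n..}. basis i) \<inter> T"
  let ?E = "generate G ((T \<inter> socle (n + Suc m)) \<union> ?B)"
  have E: "subgroup ?E G"
    using subgroup.subset[OF sub] by (intro generate_is_subgroup) blast
  have "T \<inter> socle (n + m) \<subseteq> ?E"
  proof
    fix x assume x: "x \<in> T \<inter> socle (n + m)"
    let ?C = "basis (n + m) \<inter> T"
    have C: "?C \<subseteq> carrier G" using subgroup.subset[OF sub] by auto
    obtain v w where vw: "v \<in> socle (Suc (n + m))" "w \<in> generate G ?C" "x = v \<otimes> w"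
      using generate_Un_decompose[OF subgroup_socle C basis_spans_step[OF T]] x by blast
    have wT: "w \<in> T" using vw(2) generate_subgroup_incl[OF Int_lower2 sub] by (rule rev_subsetD)
    \<comment> \<open>The deeper part \<open>v\<close> stays in \<open>T\<close>, being a quotient
      of two elements of \<open>T\<close>.\<close>
    have "v = x \<otimes> inv w" using vw wT subgroup.mem_carrier[OF sub] socle_carrier
      by (simp add: m_assoc subset_eq)
    then have "v \<in> T" using x wT by (simp add: subgroup.m_closed[OF sub] subgroup.m_inv_closed[OF sub])
    then have "v \<in> ?E" using vw by (intro generate.incl) auto
    moreover have "generate G ?C \<subseteq> ?E" by (intro mono_generate) auto
    ultimately show "x \<in> ?E" using vw subgroup.m_closed[OF E] by blast
  qed
  moreover have "?B \<subseteq> ?E" by (auto intro: generate.incl)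
  ultimately have "generate G ((T \<inter> socle (n + m)) \<union> ?B) \<subseteq> ?E"
    by (intro generate_subgroup_incl[OF _ E]) simp
  with Suc show ?case by (rule order_trans)
qed

text \<open>Inside \<open>U \<inter> F k\<close> nothing nontrivial has height \<open>k\<close> or
  more, so after \<open>k\<close> rounds only basis elements from \<open>U\<close> are left.\<close>

lemma basis_spans_U: "U \<inter> socle n \<subseteq> generate G ((\<Union>i\<in>{n..}. basis i) \<inter> U)"
proof
  fix x assume x: "x \<in> U \<inter> socle n"
  then obtain k where k: "x \<in> F k" using height_chain_exhaust[OF F] socle_carrier by blast
  let ?T = "U \<inter> F k" and ?E = "generate G ((\<Union>i\<in>{n..}. basis i) \<inter> U)"
  have sub: "subgroup ?T G" using U(1) height_chain_subgroup[OF F] by (intro subgroups_Inter_pair)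
  have E: "subgroup ?E G"
    using subgroup.subset[OF U(1)] by (intro generate_is_subgroup) auto
  have "?T \<inter> socle (n + k) \<subseteq> {\<one>}"
    using height_chain_pow[OF F, of _ k] socle_antimono[of k "n + k"] by (auto simp: height_socle_def)
  then have "?T \<inter> socle (n + k) \<union> ((\<Union>i\<in>{n..}. basis i) \<inter> ?T) \<subseteq> ?E"
    using subgroup.one_closed[OF E] by (auto intro: generate.incl)
  from generate_subgroup_incl[OF this E] show "x \<in> ?E"
    using basis_spans_iterate[OF prec_closed_U_F sub, of n k] x k by blast
qed

text \<open>Inside \<open>F' k\<close> the part left after \<open>k\<close> rounds need not be
  trivial, but it lies in \<open>U\<close> and has height at least \<open>n\<close>, so the spanning
  result for \<open>U\<close> applies to it.\<close>

lemma basis_spans_socle: "socle n \<subseteq> generate G (\<Union>i\<in>{n..}. basis i)"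
proof
  fix x assume x: "x \<in> socle n"
  then obtain k where k: "x \<in> F' k" using height_chain_exhaust[OF F'] socle_carrier by blast
  let ?E = "generate G (\<Union>i\<in>{n..}. basis i)"
  have sub: "subgroup (F' k) G" using height_chain_subgroup[OF F'] .
  have E: "subgroup ?E G"
    using socle_carrier basis_socle by (intro generate_is_subgroup) blast
  have "F' k \<inter> socle (n + k) \<subseteq> U \<inter> socle n"
    using height_chain_pow[OF F', of _ k] socle_antimono[of k "n + k"] socle_antimono[of n "n + k"]
    by (auto simp: height_socle_def)
  also have "\<dots> \<subseteq> ?E" using basis_spans_U mono_generate[of "(\<Union>i\<in>{n..}. basis i) \<inter> U"] by blast
  finally have "F' k \<inter> socle (n + k) \<union> ((\<Union>i\<in>{n..}. basis i) \<inter> F' k) \<subseteq> ?E"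
    by (auto intro: generate.incl)
  from generate_subgroup_incl[OF this E] show "x \<in> ?E"
    using basis_spans_iterate[OF prec_closed_F' sub, of n k] x k by blast
qed

section \<open>Splitting the group into pickets along the basis\<close>

definition level :: "'a \<Rightarrow> nat"
  where "level b = (THE n. b \<in> basis n)"

text \<open>The root exists because \<open>b\<close> lies in the layer of its level. It generates
  the cyclic summand with socle spanned by \<open>b\<close>, hence the exponent
  \<open>Suc (level b)\<close> in \<open>pickets\<close>.\<close>

definition gen :: "'a \<Rightarrow> 'a"
  where "gen b = (SOME g. g \<in> carrier G \<and> b = g [^] (p ^ level b))"

abbreviation full_basis :: "'a set"
  where "full_basis \<equiv> \<Union>n. basis n"

abbreviation pickets :: "('a \<Rightarrow> int) monoid"
  where "pickets \<equiv> picket_sum_group p full_basis (\<lambda>b. Suc (level b))"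

text \<open>The basis may be infinite, but elements of the direct sum have finite support, so
  \<open>gfinprod\<close> is a genuine finite product on them.\<close>

definition combine :: "('a \<Rightarrow> int) \<Rightarrow> 'a"
  where "combine x = gfinprod G (\<lambda>b. gen b [^] x b) full_basis"

lemma level_eq: "b \<in> basis n \<Longrightarrow> level b = n"
  unfolding level_def using basis_disjoint by blast

lemma
  assumes "b \<in> full_basis"
  shows gen_closed: "gen b \<in> carrier G"
    and gen_pow_level: "gen b [^] (p ^ level b) = b"
    and basis_closed: "b \<in> carrier G"
    and gen_pow: "gen b [^] (p ^ Suc (level b)) = \<one>"
proof -
  have b: "b \<in> socle (level b)" using assms basis_socle level_eq by blast
  then have "\<exists>g. g \<in> carrier G \<and> b = g [^] (p ^ level b)" by (auto simp: height_socle_def)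
  from someI_ex[OF this] show r: "gen b \<in> carrier G" "gen b [^] (p ^ level b) = b"
    unfolding gen_def by auto
  show "b \<in> carrier G" using b by (auto simp: height_socle_def)
  have p: "b [^] p = \<one>" using b by (auto simp: height_socle_def)
  have "gen b [^] (p ^ Suc (level b)) = (gen b [^] (p ^ level b)) [^] p"
    using r(1) by (simp add: nat_pow_pow mult.commute)
  then show "gen b [^] (p ^ Suc (level b)) = \<one>" using r p by simp
qed

lemma gen_pow_level_mult:
  assumes "b \<in> full_basis"
  shows "gen b [^] (int (p ^ level b) * k) = b [^] k"
proof -
  have "gen b [^] (int (p ^ level b) * k) = (gen b [^] int (p ^ level b)) [^] k"
    using gen_closed[OF assms] by (simp only: int_pow_pow)
  then show ?thesis using gen_pow_level[OF assms] by (simp only: int_pow_int)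
qed

lemma combine_hom: "combine \<in> hom pickets G"
proof -
  have "(\<lambda>k. gen b [^] k) \<in> hom (integer_mod_group (p ^ Suc (level b))) G" if "b \<in> full_basis" for b
    using gen_closed[OF that] int_pow_mod[OF gen_closed[OF that] gen_pow[OF that]]
    by (intro homI) (simp_all only: mult_integer_mod_group int_pow_mult int_pow_closed)
  then have "(\<lambda>x. gfinprod G (\<lambda>b. gen b [^] x b) full_basis)
      \<in> hom (sum_group full_basis (\<lambda>b. integer_mod_group (p ^ Suc (level b)))) G"
    by (intro hom_group_sum) auto
  then show ?thesis by (simp add: combine_def[abs_def] picket_sum_group_def)
qed

sublocale combine: group_hom pickets G combine
  using combine_hom by (auto intro!: group_hom.intro group_hom_axioms.intro)

lemma combine_single:
  assumes "b \<in> full_basis"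
  shows "combine (\<lambda>i\<in>full_basis. if i = b then k else 0) = gen b [^] k"
proof -
  have "combine (\<lambda>i\<in>full_basis. if i = b then k else 0) = gfinprod G (\<lambda>b. gen b [^] k) {b}"
    unfolding combine_def using assms gen_closed
    by (intro gfinprod_mono_neutral_cong_right) auto
  then show ?thesis using gen_closed[OF assms] by simp
qed

lemma single_closed:
  assumes "b \<in> full_basis" "0 \<le> k" "k < int (p ^ Suc (level b))"
  shows "(\<lambda>i\<in>full_basis. if i = b then k else 0) \<in> carrier pickets"
proof -
  have "finite {i \<in> full_basis. (\<lambda>i\<in>full_basis. if i = b then k else 0) i \<noteq> 0}"
    by (rule finite_subset[of _ "{b}"]) auto
  then show ?thesis
    unfolding carrier_picket_sum_group[OF p_pos] using assms p_pos by auto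
qed

lemma subgroup_image_combine: "subgroup (combine ` carrier pickets) G"
  by (rule combine.img_is_subgroup)

lemma gen_in_image:
  assumes "b \<in> full_basis" shows "gen b \<in> combine ` carrier pickets"
proof -
  \<comment> \<open>The coordinate 1 has to be a reduced residue.\<close>
  have "1 < p ^ Suc (level b)"
    using prime_gt_1_nat[OF prime] by (intro one_less_power) auto
  then have "1 < int (p ^ Suc (level b))" by linarith
  then have "(\<lambda>i\<in>full_basis. if i = b then 1 else 0) \<in> carrier pickets"
    by (rule single_closed[OF assms zero_le_one])
  moreover have "combine (\<lambda>i\<in>full_basis. if i = b then 1 else 0) = gen b"
    using combine_single[OF assms] gen_closed[OF assms] by simp
  ultimately show ?thesis by (metis (no_types) rev_image_eqI)
qed

text \<open>For \<open>x\<close> in stage \<open>k\<close>, its \<open>p ^ k\<close>-th power is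
  still in that stage and is therefore trivial.\<close>

lemma torsion:
  assumes "x \<in> carrier G" shows "\<exists>m. x [^] (p ^ m) = \<one>"
proof -
  obtain k where k: "x \<in> F k" using height_chain_exhaust[OF F assms] by blast
  have "x [^] (p ^ k) = x [^] int (p ^ k)" by (simp only: int_pow_int)
  then have "x [^] (p ^ k) \<in> F k"
    using subgroup_int_pow_closed[OF height_chain_subgroup[OF F] k] by simp
  then show ?thesis using height_chain_pow[OF F assms] by blast
qed

text \<open>A basis element of level \<open>i \<ge> m\<close> is the \<open>p ^ m\<close>-th power
  of \<open>gen b [^] (p ^ (i - m))\<close>, and such elements span the layer.\<close>

lemma socle_in_image_pow: "socle m \<subseteq> (\<lambda>x. x [^] (p ^ m)) ` (combine ` carrier pickets)"
proof -
  interpret pow: group_hom G G "\<lambda>x. x [^] (p ^ m)" by (rule pow_hom)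
  let ?D = "combine ` carrier pickets"
  have sub: "subgroup ((\<lambda>x. x [^] (p ^ m)) ` ?D) G"
    by (rule pow.subgroup_img_is_subgroup[OF subgroup_image_combine])
  have "b \<in> (\<lambda>x. x [^] (p ^ m)) ` ?D" if "b \<in> basis i" "m \<le> i" for b i
  proof -
    have b: "b \<in> full_basis" "level b = i" using that level_eq by auto
    have "gen b [^] int (p ^ (i - m)) \<in> ?D"
      using subgroup_int_pow_closed[OF subgroup_image_combine gen_in_image[OF b(1)]] .
    then have d: "gen b [^] (p ^ (i - m)) \<in> ?D" by (simp only: int_pow_int)
    have "p ^ i = p ^ (i - m) * p ^ m" using that by (simp flip: power_add)
    then have "b = (gen b [^] (p ^ (i - m))) [^] (p ^ m)"
      using gen_pow_level[OF b(1)] gen_closed[OF b(1)] b(2) by (simp add: nat_pow_pow)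
    with d show ?thesis by blast
  qed
  then have "(\<Union>i\<in>{m..}. basis i) \<subseteq> (\<lambda>x. x [^] (p ^ m)) ` ?D" by blast
  from generate_subgroup_incl[OF this sub] basis_spans_socle[of m] show ?thesis by blast
qed

text \<open>Induction on the power of \<open>p\<close> killing \<open>x\<close>: some
  \<open>d\<close> in the image has the same \<open>p ^ m\<close>-th power as \<open>x\<close>, so
  \<open>x \<otimes> inv d\<close> is killed by a smaller power.\<close>

lemma combine_surj: "combine ` carrier pickets = carrier G"
proof
  let ?D = "combine ` carrier pickets"
  have "x \<in> ?D" if "x \<in> carrier G" "x [^] (p ^ m) = \<one>" for x m
    using that
  proof (induction m arbitrary: x)
    case 0
    then show ?case using subgroup.one_closed[OF subgroup_image_combine] by simp
  next
    case (Suc m)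
    have "(x [^] (p ^ m)) [^] p = \<one>" using Suc.prems by (simp add: nat_pow_pow mult.commute)
    then have "x [^] (p ^ m) \<in> socle m" using Suc.prems(1) unfolding height_socle_def by auto
    then obtain d where d: "d \<in> ?D" "x [^] (p ^ m) = d [^] (p ^ m)" using socle_in_image_pow by blast
    have dc: "d \<in> carrier G" using subgroup.mem_carrier[OF subgroup_image_combine d(1)] .
    have "(x \<otimes> inv d) [^] (p ^ m) = \<one>"
      using d dc Suc.prems(1) by (simp add: nat_pow_distrib nat_pow_inv)
    then have "x \<otimes> inv d \<in> ?D" using Suc dc by simp
    from subgroup.m_closed[OF subgroup_image_combine this d(1)]
    show ?case using dc Suc.prems(1) by (simp add: m_assoc)
  qed
  then show "carrier G \<subseteq> ?D" using torsion by blast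
qed (rule subgroup.subset[OF subgroup_image_combine])

text \<open>Coordinates killed by \<open>p\<close> are multiples of \<open>p ^ level b\<close>, so
  \<open>combine\<close> yields a product of powers of basis elements. Independence makes each
  coordinate divisible by its modulus, and a reduced residue is then zero.\<close>

lemma combine_kernel_socle:
  assumes x: "x \<in> carrier pickets" "x [^]\<^bsub>pickets\<^esub> p = \<one>\<^bsub>pickets\<^esub>" "combine x = \<one>"
  shows "x = \<one>\<^bsub>pickets\<^esub>"
proof -
  let ?S = "{b \<in> full_basis. x b \<noteq> 0}"
  have bnd: "0 \<le> x b" "x b < int (p ^ Suc (level b))" if "b \<in> full_basis" for b
    using x(1) that p_pos by (auto simp: carrier_picket_sum_group)
  have fin: "finite ?S" and ext: "x \<in> extensional full_basis"
    using x(1) p_pos by (auto simp: carrier_picket_sum_group)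
  define c where "c b = x b div int (p ^ level b)" for b
  have c: "x b = int (p ^ level b) * c b" if "b \<in> full_basis" for b
  proof -
    have "int p * x b mod int (p ^ Suc (level b)) = 0"
      using fun_cong[OF x(2), of b] that by (simp add: pow_picket_sum_group one_picket_sum_group)
    then have "int p * int (p ^ level b) dvd int p * x b" by (simp add: mod_eq_0_iff_dvd)
    then have "int (p ^ level b) dvd x b" using p_pos by simp
    then show ?thesis by (simp add: c_def)
  qed
  have "combine x = gfinprod G (\<lambda>b. b [^] c b) ?S"
    unfolding combine_def
  proof (rule gfinprod_mono_neutral_cong_right)
    show "gen b [^] x b = b [^] c b" if "b \<in> ?S" for b
      using gen_pow_level_mult[of b "c b"] c[of b] that by simp
  qed (use gen_closed in auto)
  also have "\<dots> = (\<Otimes>b\<in>?S. b [^] c b)"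
    using fin basis_closed by (intro gfinprod_eq_finprod) auto
  finally have eq: "(\<Otimes>b\<in>?S. b [^] c b) = \<one>" using x(3) by simp
  have "x b = 0" if b: "b \<in> full_basis" for b
  proof (rule ccontr)
    assume "x b \<noteq> 0"
    then have "int p dvd c b" using b by (intro basis_independent[OF fin _ eq]) auto
    then have "int (p ^ Suc (level b)) dvd x b"
      unfolding c[OF b] by (simp add: mult.commute)
    then show False using bnd[OF b] \<open>x b \<noteq> 0\<close> by (auto dest: zdvd_imp_le)
  qed
  then show ?thesis using ext by (auto simp: one_picket_sum_group extensional_def)
qed

text \<open>Induction on the power of \<open>p\<close> killing \<open>x\<close>: the
  \<open>p ^ m\<close>-th power of \<open>x\<close> is a kernel element killed by \<open>p\<close>,
  hence trivial.\<close>

lemma combine_inj: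
  assumes "x \<in> carrier pickets" "combine x = \<one>"
  shows "x = \<one>\<^bsub>pickets\<^esub>"
proof -
  have *: "x = \<one>\<^bsub>pickets\<^esub>"
    if "x \<in> carrier pickets" "combine x = \<one>" "x [^]\<^bsub>pickets\<^esub> (p ^ m) = \<one>\<^bsub>pickets\<^esub>" for x m
    using that
  proof (induction m arbitrary: x)
    case 0
    then show ?case by simp
  next
    case (Suc m)
    let ?y = "x [^]\<^bsub>pickets\<^esub> (p ^ m)"
    have "?y [^]\<^bsub>pickets\<^esub> p = \<one>\<^bsub>pickets\<^esub>"
      using Suc.prems(1,3) by (simp add: combine.G.nat_pow_pow mult.commute)
    moreover have "combine ?y = \<one>"
      using Suc.prems(1,2) by (simp add: combine.hom_nat_pow)
    ultimately have "?y = \<one>\<^bsub>pickets\<^esub>"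
      using Suc.prems(1) combine.G.nat_pow_closed combine_kernel_socle by blast
    with Suc.IH[OF Suc.prems(1,2)] show ?case .
  qed
  \<comment> \<open>A stage of the explicit chain containing \<open>x\<close> bounds the exponents
    on its support, which gives a power of \<open>p\<close> killing it.\<close>
  obtain k where "x \<in> {x \<in> carrier pickets. \<forall>i\<in>full_basis. k < Suc (level i) \<longrightarrow> x i = 0}"
    using height_chain_exhaust[OF height_chain_picket_sum[OF p_pos] assms(1)] by blast
  then have k: "x i = 0" if "i \<in> full_basis" "k < Suc (level i)" for i using that by blast
  have "x [^]\<^bsub>pickets\<^esub> (p ^ k) = \<one>\<^bsub>pickets\<^esub>"
    unfolding pow_picket_sum_group one_picket_sum_group
  proof (rule restrict_ext)
    fix i assume i: "i \<in> full_basis"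
    show "int (p ^ k) * x i mod int (p ^ Suc (level i)) = 0"
    proof (cases "k < Suc (level i)")
      case True
      then show ?thesis using k[OF i] by simp
    next
      case False
      then have "p ^ Suc (level i) dvd p ^ k" by (intro le_imp_power_dvd) simp
      then have "int (p ^ Suc (level i)) dvd int (p ^ k)" by (simp only: int_dvd_int_iff)
      then show ?thesis by (intro dvd_imp_mod_0 dvd_mult2)
    qed
  qed
  with * assms show ?thesis by blast
qed

text \<open>The distinguished part of a summand with \<open>b \<in> U\<close> consists of the
  multiples of \<open>p ^ level b\<close>, which go to the powers of \<open>b\<close>. The basis
  elements in \<open>U\<close> span \<open>U\<close>.\<close>

lemma combine_picket_sum_sub:
  "combine ` picket_sum_sub p full_basis (\<lambda>b. Suc (level b)) (\<lambda>b. b \<in> U) = U" (is "combine ` ?V = U")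
proof
  have sub: "subgroup ?V pickets" using p_pos by (intro subgroup_picket_sum_sub) auto
  show "combine ` ?V \<subseteq> U"
  proof
    fix y assume "y \<in> combine ` ?V"
    then obtain x where x: "x \<in> ?V" "y = combine x" by blast
    have "gen b [^] x b \<in> U" if b: "b \<in> full_basis" for b
    proof (cases "b \<in> U")
      case True
      have "x b \<in> picket_sub p (Suc (level b)) (b \<in> U)"
        using x(1) b unfolding picket_sum_sub_def by blast
      then obtain k where "x b = int (p ^ level b) * k"
        using True by (auto simp: picket_sub_def)
      then show ?thesis
        using gen_pow_level_mult[OF b, of k] subgroup_int_pow_closed[OF U(1) True] by simp
    next
      case False
      have "x b \<in> picket_sub p (Suc (level b)) (b \<in> U)"
        using x(1) b unfolding picket_sum_sub_def by blast
      then have "x b = 0" using False by (auto simp: picket_sub_def)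
      then show ?thesis using subgroup.one_closed[OF U(1)] by simp
    qed
    \<comment> \<open>Unfolding \<open>gfinprod\<close> also produces its default value for infinite
      support, the identity, which lies in \<open>U\<close>.\<close>
    then show "y \<in> U"
      unfolding x(2) combine_def gfinprod_def
      using subgroup.one_closed[OF U(1)] by (auto intro!: finprod_in_subgroup[OF U(1)])
  qed
  have subi: "subgroup (combine ` ?V) G" by (rule combine.subgroup_img_is_subgroup[OF sub])
  have "b \<in> combine ` ?V" if "b \<in> full_basis" "b \<in> U" for b
  proof -
    let ?k = "int (p ^ level b)"
    let ?e = "\<lambda>i\<in>full_basis. if i = b then ?k else 0"
    have lt: "p ^ level b < p ^ Suc (level b)"
      using prime_gt_1_nat[OF prime] by (intro power_strict_increasing) auto
    then have "?k < int (p ^ Suc (level b))" by linarith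
    then have "?e \<in> carrier pickets" by (rule single_closed[OF that(1) of_nat_0_le_iff])
    moreover have "?k \<in> picket_sub p (Suc (level b)) True"
      using lt p_pos by (subst mem_picket_sub) auto
    ultimately have "?e \<in> ?V"
      using that p_pos by (auto simp: picket_sum_sub_def) (auto simp: picket_sub_def)
    moreover have "combine ?e = b"
      using combine_single[OF that(1), of ?k] gen_pow_level_mult[OF that(1), of 1] basis_closed[OF that(1)]
      by simp
    ultimately show ?thesis by (metis (no_types) rev_image_eqI)
  qed
  then have "(\<Union>i\<in>{0..}. basis i) \<inter> U \<subseteq> combine ` ?V" by auto
  from generate_subgroup_incl[OF this subi] basis_spans_U[of 0]
  have "U \<inter> socle 0 \<subseteq> combine ` ?V" by blast
  moreover have "U \<subseteq> socle 0" using U subgroup.subset[OF U(1)] by (auto simp: socle_0)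
  ultimately show "U \<subseteq> combine ` ?V" by blast
qed

lemma pair_iso_picket_sum:
  "pair_iso G U pickets (picket_sum_sub p full_basis (\<lambda>b. Suc (level b)) (\<lambda>b. b \<in> U))"
proof (rule pair_iso_sym)
  have "inj_on combine (carrier pickets)"
    using combine_inj by (simp add: combine.inj_on_one_iff)
  then have "combine \<in> iso pickets G"
    using combine_hom combine_surj by (simp add: iso_def bij_betw_def)
  then show "pair_iso pickets (picket_sum_sub p full_basis (\<lambda>b. Suc (level b)) (\<lambda>b. b \<in> U)) G U"
    using combine_picket_sum_sub by (auto simp: pair_iso_def)
qed (auto simp: picket_sum_sub_def)

end

section \<open>The quotient of a direct sum of pickets\<close>

text \<open>Factoring out the subgroup lowers the exponent by one on summands of type
  \<open>P\<^sup>n\<^sub>1\<close> and leaves the others unchanged. Coordinatewise reduction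
  realises the projection. Exponent 0 may arise, and \<open>dsum_cyclic_p\<close> admits it as a
  trivial summand.\<close>

lemma dsum_cyclic_p_quotient:
  fixes I :: "'i set"
  assumes p: "p > 0" and grp: "group G" and U: "U \<subseteq> carrier G"
    and n: "\<And>i. i \<in> I \<Longrightarrow> n i \<ge> 1"
    and iso: "pair_iso G U (picket_sum_group p I n) (picket_sum_sub p I n t)"
  shows "dsum_cyclic_p TYPE('i) p (G Mod U)"
proof -
  define m where "m i = (if t i then n i - 1 else n i)" for i
  let ?P = "picket_sum_group p I n" and ?Q = "picket_sum_group p I m"
  let ?\<phi> = "\<lambda>x. \<lambda>i\<in>I. x i mod int (p ^ m i)"
  obtain h where h: "h \<in> iso G ?P" "h ` U = picket_sum_sub p I n t"
    using iso by (auto simp: pair_iso_def)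
  have le: "p ^ m i \<le> p ^ n i" for i using p by (intro power_increasing) (auto simp: m_def)
  have dv: "int (p ^ m i) dvd int (p ^ n i)" for i
    by (simp add: m_def le_imp_power_dvd)
  have "?\<phi> x \<in> carrier ?Q" if "x \<in> carrier ?P" for x
  proof -
    have "finite {i \<in> I. x i \<noteq> 0}" using that p by (simp add: carrier_picket_sum_group)
    then have "finite {i \<in> I. x i mod int (p ^ m i) \<noteq> 0}" by (rule rev_finite_subset) auto
    moreover have "{i \<in> I. ?\<phi> x i \<noteq> 0} = {i \<in> I. x i mod int (p ^ m i) \<noteq> 0}" by auto
    ultimately show ?thesis
      unfolding carrier_picket_sum_group[OF p] using p by simp
  qed
  moreover have "?\<phi> (x \<otimes>\<^bsub>?P\<^esub> y) = ?\<phi> x \<otimes>\<^bsub>?Q\<^esub> ?\<phi> y" for x y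
    unfolding mult_picket_sum_group
    by (rule restrict_ext) (simp only: restrict_apply' mod_mod_cancel[OF dv] mod_add_eq)
  ultimately have hom: "?\<phi> \<in> hom ?P ?Q" by (intro homI)
  have hom': "h \<in> hom G ?P" using h by (simp add: iso_def)
  interpret \<phi>h: group_hom G ?Q "?\<phi> \<circ> h"
    using grp Group.hom_compose[OF hom' hom] by (auto intro!: group_hom.intro group_hom_axioms.intro)
  have "y \<in> ?\<phi> ` carrier ?P" if y: "y \<in> carrier ?Q" for y
  proof -
    have "y i < int (p ^ n i)" if "i \<in> I" for i
    proof -
      have "y i < int (p ^ m i)" using y that p by (simp add: carrier_picket_sum_group)
      also have "\<dots> \<le> int (p ^ n i)" using le by (simp only: of_nat_le_iff)
      finally show ?thesis .
    qed
    then have "y \<in> carrier ?P" using y unfolding carrier_picket_sum_group[OF p] by blast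
    moreover have "y = ?\<phi> y"
      using y unfolding carrier_picket_sum_group[OF p] by (auto simp: extensional_def fun_eq_iff)
    ultimately show ?thesis by blast
  qed
  then have "?\<phi> ` carrier ?P = carrier ?Q" using hom by (auto simp: hom_def)
  then have surj: "(?\<phi> \<circ> h) ` carrier G = carrier ?Q"
    using h by (simp only: image_comp[symmetric]) (simp add: iso_def bij_betw_def)
  have "x \<in> U \<longleftrightarrow> (?\<phi> \<circ> h) x = \<one>\<^bsub>?Q\<^esub>" if x: "x \<in> carrier G" for x
  proof -
    have hx: "h x \<in> carrier ?P" using hom' x by (auto simp: hom_def)
    have inj: "inj_on h (carrier G)" using h by (simp add: iso_def bij_betw_def)
    have "x \<in> U \<longleftrightarrow> h x \<in> picket_sum_sub p I n t"
      unfolding h(2)[symmetric] using inj_on_image_mem_iff[OF inj x U] by simp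
    also have "\<dots> \<longleftrightarrow> (\<forall>i\<in>I. int (p ^ m i) dvd h x i)"
    proof -
      have "h x i \<in> picket_sub p (n i) (t i) \<longleftrightarrow> int (p ^ m i) dvd h x i" if i: "i \<in> I" for i
      proof -
        have b: "0 \<le> h x i" "h x i < int (p ^ n i)"
          using hx i unfolding carrier_picket_sum_group[OF p] by auto
        \<comment> \<open>For reduced residues vanishing is divisibility by the full modulus, so
          both types obey the same criterion with \<open>m i\<close>.\<close>
        then have "int (p ^ n i) dvd h x i \<longleftrightarrow> h x i = 0"
          by (metis dvd_0_right dvd_imp_mod_0 mod_pos_pos_trivial)
        then show ?thesis using mem_picket_sub[OF p n[OF i] b] by (simp add: m_def)
      qed
      then show ?thesis using hx by (simp add: picket_sum_sub_def)
    qed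
    also have "\<dots> \<longleftrightarrow> (?\<phi> \<circ> h) x = \<one>\<^bsub>?Q\<^esub>"
      by (auto simp: one_picket_sum_group fun_eq_iff mod_eq_0_iff_dvd)
    finally show ?thesis .
  qed
  then have "kernel G ?Q (?\<phi> \<circ> h) = U" using U by (auto simp: kernel_def)
  with \<phi>h.FactGroup_iso[OF surj] have "G Mod U \<cong> ?Q" by simp
  then show ?thesis unfolding dsum_cyclic_p_def picket_sum_group_def by blast
qed

section \<open>Counting the summands\<close>

text \<open>For exponents at least 1 this is the part of the socle supported on \<open>Q\<close>.
  Intersections and products of such groups become intersections and unions of index sets.\<close>

definition coord_socle :: "nat \<Rightarrow> 'i set \<Rightarrow> ('i \<Rightarrow> nat) \<Rightarrow> 'i set \<Rightarrow> ('i \<Rightarrow> int) set"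
  where "coord_socle p I n Q = {x \<in> carrier (picket_sum_group p I n).
    \<forall>i\<in>I. int (p ^ (n i - 1)) dvd x i \<and> (i \<notin> Q \<longrightarrow> x i = 0)}"

lemma picket_sum_sub_eq_coord_socle:
  assumes "p > 0" "\<And>i. i \<in> I \<Longrightarrow> n i \<ge> 1"
  shows "picket_sum_sub p I n t = coord_socle p I n {i. t i}"
  using assms
  by (auto simp: picket_sum_sub_def coord_socle_def carrier_picket_sum_group mem_picket_sub split: if_splits)

lemma coord_socle_Int: "coord_socle p I n Q \<inter> coord_socle p I n R = coord_socle p I n (Q \<inter> R)"
  by (auto simp: coord_socle_def)

lemma coord_socle_set_mult:
  assumes p: "p > 0"
  shows "coord_socle p I n Q <#>\<^bsub>picket_sum_group p I n\<^esub> coord_socle p I n R = coord_socle p I n (Q \<union> R)"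
proof (intro subset_antisym subsetI)
  let ?P = "picket_sum_group p I n"
  have d: "int (p ^ (n i - 1)) dvd int (p ^ n i)" for i
    by (simp add: le_imp_power_dvd)
  fix z
  assume "z \<in> coord_socle p I n Q <#>\<^bsub>?P\<^esub> coord_socle p I n R"
  then obtain x y where xy: "x \<in> coord_socle p I n Q" "y \<in> coord_socle p I n R" "z = x \<otimes>\<^bsub>?P\<^esub> y"
    by (auto simp: set_mult_def)
  then have "z \<in> carrier ?P"
    using monoid.m_closed[OF group.is_monoid[OF group_picket_sum_group]] by (auto simp: coord_socle_def)
  then show "z \<in> coord_socle p I n (Q \<union> R)"
    using xy d by (auto simp: coord_socle_def mult_picket_sum_group intro!: dvd_mod dvd_add)
next
  let ?P = "picket_sum_group p I n"
  fix z assume z: "z \<in> coord_socle p I n (Q \<union> R)"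
  \<comment> \<open>Indices in both sets are assigned to the first factor.\<close>
  let ?x = "\<lambda>i\<in>I. if i \<in> Q then z i else 0" and ?y = "\<lambda>i\<in>I. if i \<in> Q then 0 else z i"
  have fin: "finite {i \<in> I. z i \<noteq> 0}" using z p by (simp add: coord_socle_def carrier_picket_sum_group)
  have "finite {i \<in> I. ?x i \<noteq> 0}" "finite {i \<in> I. ?y i \<noteq> 0}"
    by (rule finite_subset[OF _ fin], auto split: if_splits)+
  then have "?x \<in> coord_socle p I n Q" "?y \<in> coord_socle p I n R"
    using z p unfolding coord_socle_def carrier_picket_sum_group[OF p] by auto
  moreover have "z = ?x \<otimes>\<^bsub>?P\<^esub> ?y"
    using z p by (auto simp: coord_socle_def carrier_picket_sum_group mult_picket_sum_group
        fun_eq_iff extensional_def)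
  ultimately show "z \<in> coord_socle p I n Q <#>\<^bsub>?P\<^esub> coord_socle p I n R"
    unfolding set_mult_def by blast
qed

text \<open>The socle of a summand of exponent \<open>n i\<close> is generated by
  \<open>p ^ (n i - 1)\<close>, which is divisible by \<open>p ^ m\<close> exactly when
  \<open>m < n i\<close>. Dividing every coordinate by \<open>p ^ m\<close> gives the required
  root.\<close>

lemma height_socle_picket_sum_group:
  assumes p: "p > 0" and n: "\<And>i. i \<in> I \<Longrightarrow> n i \<ge> 1"
  shows "height_socle p (picket_sum_group p I n) m = coord_socle p I n {i. m < n i}"
proof (intro subset_antisym subsetI)
  let ?P = "picket_sum_group p I n"
  have pn: "int (p ^ n i) = int p * int (p ^ (n i - 1))" if "i \<in> I" for i
    using n[OF that] by (cases "n i") simp_all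
  fix x assume "x \<in> height_socle p ?P m"
  then obtain g where x: "x \<in> carrier ?P" "x [^]\<^bsub>?P\<^esub> p = \<one>\<^bsub>?P\<^esub>" and g: "x = g [^]\<^bsub>?P\<^esub> (p ^ m)"
    by (auto simp: height_socle_def)
  have "int (p ^ (n i - 1)) dvd x i" if "i \<in> I" for i
  proof -
    have "int p * x i mod int (p ^ n i) = 0"
      using fun_cong[OF x(2), of i] that by (simp add: pow_picket_sum_group one_picket_sum_group)
    then have "int p * int (p ^ (n i - 1)) dvd int p * x i" using pn[OF that] by (simp add: mod_eq_0_iff_dvd)
    then show ?thesis using p by simp
  qed
  moreover have "x i = 0" if "i \<in> I" "\<not> m < n i" for i
  proof -
    have "p ^ n i dvd p ^ m" using that by (intro le_imp_power_dvd) simp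
    then have "int (p ^ n i) dvd int (p ^ m)" by (simp only: int_dvd_int_iff)
    then have "int (p ^ m) * g i mod int (p ^ n i) = 0" by (intro dvd_imp_mod_0 dvd_mult2)
    then show ?thesis using that unfolding g pow_picket_sum_group by simp
  qed
  ultimately show "x \<in> coord_socle p I n {i. m < n i}" using x(1) by (auto simp: coord_socle_def)
next
  let ?P = "picket_sum_group p I n"
  have pn: "int (p ^ n i) = int p * int (p ^ (n i - 1))" if "i \<in> I" for i
    using n[OF that] by (cases "n i") simp_all
  fix x assume x: "x \<in> coord_socle p I n {i. m < n i}"
  then have xP: "x \<in> carrier ?P" and d: "\<And>i. i \<in> I \<Longrightarrow> int (p ^ (n i - 1)) dvd x i"
    and z: "\<And>i. i \<in> I \<Longrightarrow> \<not> m < n i \<Longrightarrow> x i = 0" by (auto simp: coord_socle_def)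
  have b: "0 \<le> x i" "x i < int (p ^ n i)" if "i \<in> I" for i
    using xP that by (auto simp: carrier_picket_sum_group[OF p])
  let ?g = "\<lambda>i\<in>I. x i div int (p ^ m)"
  have "?g \<in> carrier ?P"
  proof -
    have "x i div int (p ^ m) < int (p ^ n i)" if "i \<in> I" for i
    proof -
      have "x i div int (p ^ m) \<le> x i div 1"
        using b[OF that] p by (intro zdiv_mono2) (simp_all add: Suc_le_eq int_one_le_iff_zero_less)
      then show ?thesis using b(2)[OF that] by simp
    qed
    moreover have "0 \<le> x i div int (p ^ m)" if "i \<in> I" for i
      using b[OF that] p by (simp add: pos_imp_zdiv_nonneg_iff)
    moreover have "finite {i \<in> I. x i \<noteq> 0}" using xP by (simp add: carrier_picket_sum_group[OF p])
    then have "finite {i \<in> I. ?g i \<noteq> 0}" by (rule rev_finite_subset) auto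
    ultimately show ?thesis unfolding carrier_picket_sum_group[OF p] by simp
  qed
  moreover have "x = ?g [^]\<^bsub>?P\<^esub> (p ^ m)"
  proof
    fix i
    show "x i = (?g [^]\<^bsub>?P\<^esub> (p ^ m)) i"
    proof (cases "i \<in> I")
      case True
      have "int (p ^ m) dvd x i"
      proof (cases "m < n i")
        case False
        then show ?thesis using z True by simp
      next
        case less: True
        then have "p ^ m dvd p ^ (n i - 1)" by (intro le_imp_power_dvd) simp
        then have "int (p ^ m) dvd int (p ^ (n i - 1))" by (simp only: int_dvd_int_iff)
        then show ?thesis using d[OF True] by (rule dvd_trans)
      qed
      then have "int (p ^ m) * (x i div int (p ^ m)) = x i" by simp
      then show ?thesis using True b[OF True] unfolding pow_picket_sum_group by simp
    next
      case False
      then show ?thesis using xP by (simp add: carrier_picket_sum_group[OF p] pow_picket_sum_group extensional_def)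
    qed
  qed
  moreover have "x [^]\<^bsub>?P\<^esub> p = \<one>\<^bsub>?P\<^esub>"
    unfolding pow_picket_sum_group one_picket_sum_group
  proof (rule restrict_ext)
    fix i assume i: "i \<in> I"
    show "int p * x i mod int (p ^ n i) = 0"
      unfolding pn[OF i] using d[OF i] by (intro dvd_imp_mod_0 mult_dvd_mono) auto
  qed
  ultimately show "x \<in> height_socle p ?P m" using xP unfolding height_socle_def by blast
qed

lemma iso_height_socle:
  assumes "group G" "group H" "f \<in> iso G H"
  shows "f ` height_socle p G m = height_socle p H m"
proof -
  interpret f: group_hom G H f
    using assms by (auto intro!: group_hom.intro group_hom_axioms.intro simp: iso_def)
  have inj: "inj_on f (carrier G)" and surj: "f ` carrier G = carrier H"
    using assms(3) by (auto simp: iso_def bij_betw_def)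
  show ?thesis
  proof (intro subset_antisym subsetI)
    fix y assume "y \<in> f ` height_socle p G m"
    then obtain g where g: "g \<in> carrier G" "y = f (g [^]\<^bsub>G\<^esub> (p ^ m))"
        "(g [^]\<^bsub>G\<^esub> (p ^ m)) [^]\<^bsub>G\<^esub> p = \<one>\<^bsub>G\<^esub>"
      by (auto simp: height_socle_def)
    then have "y [^]\<^bsub>H\<^esub> p = \<one>\<^bsub>H\<^esub>" "y = f g [^]\<^bsub>H\<^esub> (p ^ m)"
      by (metis f.G.nat_pow_closed f.hom_nat_pow f.hom_one) (use g in \<open>simp add: f.hom_nat_pow\<close>)
    then show "y \<in> height_socle p H m" using g(1) unfolding height_socle_def by auto
  next
    fix y assume "y \<in> height_socle p H m"
    then obtain g where g: "g \<in> carrier G" "y = f g [^]\<^bsub>H\<^esub> (p ^ m)" "y [^]\<^bsub>H\<^esub> p = \<one>\<^bsub>H\<^esub>"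
      unfolding height_socle_def surj[symmetric] by blast
    let ?x = "g [^]\<^bsub>G\<^esub> (p ^ m)"
    have x: "?x \<in> carrier G" "y = f ?x" using g by (simp_all add: f.hom_nat_pow)
    have "f (?x [^]\<^bsub>G\<^esub> p) = f \<one>\<^bsub>G\<^esub>" using x g(3) f.hom_nat_pow[OF x(1)] by simp
    then have "?x [^]\<^bsub>G\<^esub> p = \<one>\<^bsub>G\<^esub>"
      using inj_onD[OF inj] x(1) f.G.nat_pow_closed f.G.one_closed by blast
    then show "y \<in> f ` height_socle p G m" using x g(1) unfolding height_socle_def by blast
  qed
qed

text \<open>A coordinate in \<open>D\<close> is \<open>p ^ (n i - 1)\<close> times a digit below
  \<open>p\<close>, and the digits are arbitrary.\<close>

lemma finite_coord_socle:
  assumes p: "p > 0" and n: "\<And>i. i \<in> I \<Longrightarrow> n i \<ge> 1" and D: "D \<subseteq> I" "finite D"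
  shows "finite (coord_socle p I n D) \<and> card (coord_socle p I n D) = p ^ card D"
proof -
  let ?C = "coord_socle p I n D" and ?q = "\<lambda>i. int (p ^ (n i - 1))"
  let ?W = "PiE D (\<lambda>_. {0..<int p})"
  let ?f = "\<lambda>x. \<lambda>i\<in>D. x i div ?q i" and ?g = "\<lambda>y. \<lambda>i\<in>I. if i \<in> D then ?q i * y i else 0"
  have pn: "int (p ^ n i) = ?q i * int p" if "i \<in> I" for i
    using n[OF that] by (cases "n i") simp_all
  have q: "?q i > 0" for i using p by simp
  have "bij_betw ?f ?C ?W"
  proof (rule bij_betw_byWitness[where f' = ?g])
    show "\<forall>x\<in>?C. ?g (?f x) = x"
      using D(1) by (auto simp: coord_socle_def carrier_picket_sum_group[OF p] fun_eq_iff extensional_def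
          simp del: of_nat_power)
    show "\<forall>y\<in>?W. ?f (?g y) = y"
      using D(1) q p by (auto simp: fun_eq_iff PiE_iff extensional_def)
    show "?f ` ?C \<subseteq> ?W"
    proof
      fix y assume "y \<in> ?f ` ?C"
      then obtain x where x: "x \<in> ?C" "y = ?f x" by blast
      have "0 \<le> x i div ?q i" "x i div ?q i < int p" if i: "i \<in> D" for i
      proof -
        have iI: "i \<in> I" using i D(1) by blast
        then have x': "0 \<le> x i" "x i < int (p ^ n i)" "?q i dvd x i"
          using x(1) unfolding coord_socle_def carrier_picket_sum_group[OF p] by blast+
        obtain c where c: "x i = ?q i * c" using x'(3) by (rule dvdE)
        have "x i div ?q i = c" unfolding c using p by simp
        moreover have "0 \<le> c" using x'(1) q[of i] zero_le_mult_iff[of "?q i" c] unfolding c by linarith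
        moreover have "c < int p" using x'(2) mult_less_cancel_left_pos[OF q[of i]] unfolding c pn[OF iI] by blast
        ultimately show "0 \<le> x i div ?q i" "x i div ?q i < int p" by simp_all
      qed
      then show "y \<in> ?W" using x(2) by auto
    qed
    show "?g ` ?W \<subseteq> ?C"
    proof
      fix x assume "x \<in> ?g ` ?W"
      then obtain y where y: "y \<in> ?W" "x = ?g y" by blast
      have "0 \<le> x i \<and> x i < int (p ^ n i) \<and> ?q i dvd x i" if i: "i \<in> I" for i
      proof (cases "i \<in> D")
        case True
        then have "0 \<le> y i" "y i < int p" using y(1) by auto
        then show ?thesis using y(2) True i q[of i] pn[OF i] by simp
      next
        case False
        then show ?thesis using y(2) i p by simp
      qed
      moreover have "finite {i \<in> I. x i \<noteq> 0}"
        by (rule finite_subset[OF _ D(2)]) (use y(2) in auto)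
      moreover have "x \<in> extensional I" "\<forall>i\<in>I. i \<notin> D \<longrightarrow> x i = 0" using y(2) by auto
      ultimately show "x \<in> ?C" unfolding coord_socle_def carrier_picket_sum_group[OF p] by blast
    qed
  qed
  from bij_betw_finite[OF this] bij_betw_same_card[OF this] show ?thesis
    using D(2) by (simp add: card_PiE finite_PiE)
qed

text \<open>A vector is determined by the finite graph of its nonzero part, and an infinite
  \<open>D\<close> has as many finite subsets of \<open>D \<times> UNIV\<close> over the integers as
  elements. Conversely each index carries a nonzero vector.\<close>

lemma infinite_coord_socle:
  assumes p: "p > 1" and n: "\<And>i. i \<in> I \<Longrightarrow> n i \<ge> 1" and D: "D \<subseteq> I" "infinite D"
  shows "coord_socle p I n D \<approx> D"
proof (rule lepoll_antisym)
  let ?C = "coord_socle p I n D"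
  have p0: "p > 0" using p by simp
  have "inj_on (\<lambda>x. {(i, x i) |i. i \<in> D \<and> x i \<noteq> 0}) ?C"
  proof (rule inj_onI, rule ext)
    fix x y i
    assume xy: "x \<in> ?C" "y \<in> ?C" and eq: "{(i, x i) |i. i \<in> D \<and> x i \<noteq> 0} = {(i, y i) |i. i \<in> D \<and> y i \<noteq> 0}"
    have "(i, c) \<in> {(i, x i) |i. i \<in> D \<and> x i \<noteq> 0} \<longleftrightarrow> (i, c) \<in> {(i, y i) |i. i \<in> D \<and> y i \<noteq> 0}" for c
      by (simp only: eq)
    then have "x i = y i" if "i \<in> D" using that by (simp) metis
    moreover have "x i = y i" if "i \<notin> D"
      using that xy by (cases "i \<in> I") (auto simp: coord_socle_def carrier_picket_sum_group[OF p0] extensional_def)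
    ultimately show "x i = y i" by blast
  qed
  moreover have "finite {(i, x i) |i. i \<in> D \<and> x i \<noteq> 0}" if "x \<in> ?C" for x
  proof -
    have "finite {i \<in> I. x i \<noteq> 0}" using that by (simp add: coord_socle_def carrier_picket_sum_group[OF p0])
    then have "finite ((\<lambda>i. (i, x i)) ` {i \<in> I. x i \<noteq> 0})" by (rule finite_imageI)
    then show ?thesis by (rule rev_finite_subset) (use D(1) in auto)
  qed
  ultimately have "?C \<lesssim> Fpow (D \<times> (UNIV :: int set))"
    unfolding lepoll_def Fpow_def by blast
  also have "Fpow (D \<times> (UNIV :: int set)) \<approx> D \<times> (UNIV :: int set)"
    using D(2) by (intro eqpoll_Fpow) (auto simp: finite_cartesian_product_iff)
  also have "D \<times> (UNIV :: int set) \<approx> D"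
  proof -
    have "(card_of (UNIV :: int set), card_of D) \<in> ordLeq"
      using infinite_iff_card_of_countable[of "UNIV :: int set" D] D(2) by (simp add: infinite_UNIV_char_0)
    then show ?thesis
      using card_of_Times_infinite[OF D(2), of "UNIV :: int set"] by (simp add: eqpoll_iff_card_of_ordIso)
  qed
  finally show "?C \<lesssim> D" .
  let ?e = "\<lambda>d. \<lambda>i\<in>I. if i = d then int (p ^ (n i - 1)) else 0"
  have "inj_on ?e D"
  proof (rule inj_onI)
    fix a b assume "a \<in> D" "b \<in> D" "?e a = ?e b"
    then have "?e a a = ?e b a" "a \<in> I" using D by auto
    then show "a = b" using p0 by (auto split: if_splits)
  qed
  moreover have "?e d \<in> ?C" if d: "d \<in> D" for d
  proof -
    have "finite {i \<in> I. ?e d i \<noteq> 0}" by (rule finite_subset[of _ "{d}"]) auto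
    moreover have "p ^ (n i - 1) < p ^ n i" if "i \<in> I" for i
      using n[OF that] p by (intro power_strict_increasing) auto
    then have "int (p ^ (n i - 1)) < int (p ^ n i)" if "i \<in> I" for i
      using that by (simp only: of_nat_less_iff)
    then have "?e d i < int (p ^ n i)" if "i \<in> I" for i
      using that p0 by (auto simp del: of_nat_power)
    ultimately show ?thesis
      unfolding coord_socle_def carrier_picket_sum_group[OF p0] using d by auto
  qed
  ultimately show "D \<lesssim> ?C" unfolding lepoll_def by blast
qed

text \<open>Recovers the rank from the cardinality: by injectivity of powers of \<open>p\<close> in
  the finite case, directly in the infinite one.\<close>

lemma coord_socle_eqpoll_imp_eqpoll:
  assumes p: "p > 1"
    and n: "\<And>i. i \<in> I \<Longrightarrow> n i \<ge> 1" and D: "D \<subseteq> I"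
    and m: "\<And>j. j \<in> J \<Longrightarrow> m j \<ge> 1" and E: "E \<subseteq> J"
    and eq: "coord_socle p I n D \<approx> coord_socle p J m E"
  shows "D \<approx> E"
proof -
  have p0: "p > 0" using p by simp
  have inf: "infinite (coord_socle p I n D) \<longleftrightarrow> infinite D"
    using finite_coord_socle[of p I n D, OF p0 n D] eqpoll_finite_iff[OF infinite_coord_socle[of p I n D, OF p n D]] by blast
  have inf': "infinite (coord_socle p J m E) \<longleftrightarrow> infinite E"
    using finite_coord_socle[of p J m E, OF p0 m E] eqpoll_finite_iff[OF infinite_coord_socle[of p J m E, OF p m E]] by blast
  show ?thesis
  proof (cases "finite D")
    case True
    then have fin: "finite D" "finite E" using inf inf' eqpoll_finite_iff[OF eq] by auto
    then have "p ^ card D = p ^ card E"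
      using finite_coord_socle[of p I n D, OF p0 n D fin(1)] finite_coord_socle[of p J m E, OF p0 m E fin(2)] eq
      by (simp add: eqpoll_iff_card)
    then show ?thesis using p fin by (simp add: eqpoll_iff_card)
  next
    case False
    then have "infinite E" using inf inf' eqpoll_finite_iff[OF eq] by auto
    then show ?thesis
      using eqpoll_sym[OF infinite_coord_socle[of p I n D, OF p n D False]] eq infinite_coord_socle[of p J m E, OF p m E]
      by (blast intro: eqpoll_trans)
  qed
qed

text \<open>The map \<open>\<rho>\<close> is \<open>f\<close> followed by forgetting the coordinates
  outside \<open>Q - R\<close>. Its fibres on \<open>A\<close> are the classes modulo
  \<open>K\<close>, so it describes the quotient without forming a factor group.\<close>

lemma coset_surjection_coord_socle:
  assumes p: "p > 0" and grp: "group G" and f: "f \<in> iso G (picket_sum_group p I n)"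
    and A: "A \<subseteq> carrier G" "f ` A = coord_socle p I n Q"
    and K: "K \<subseteq> carrier G" "f ` K = coord_socle p I n R"
  shows "\<exists>\<rho>. \<rho> ` A = coord_socle p I n (Q - R) \<and>
    (\<forall>x\<in>A. \<forall>y\<in>A. \<rho> x = \<rho> y \<longleftrightarrow> x \<otimes>\<^bsub>G\<^esub> inv\<^bsub>G\<^esub> y \<in> K)"
proof (intro exI conjI ballI)
  let ?P = "picket_sum_group p I n"
  let ?r = "\<lambda>x. \<lambda>i\<in>I. if i \<in> Q - R then x i else 0"
  interpret f: group_hom G ?P f
    using grp f by (auto intro!: group_hom.intro group_hom_axioms.intro simp: iso_def)
  have inj: "inj_on f (carrier G)" using f by (auto simp: iso_def bij_betw_def)
  have "?r ` coord_socle p I n Q = coord_socle p I n (Q - R)"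
  proof (intro subset_antisym subsetI)
    fix y assume "y \<in> ?r ` coord_socle p I n Q"
    then obtain x where x: "x \<in> coord_socle p I n Q" "y = ?r x" by blast
    have "finite {i \<in> I. x i \<noteq> 0}" using x(1) by (simp add: coord_socle_def carrier_picket_sum_group[OF p])
    then have "finite {i \<in> I. y i \<noteq> 0}" by (rule rev_finite_subset) (auto simp: x(2) split: if_splits)
    then show "y \<in> coord_socle p I n (Q - R)"
      using x p unfolding coord_socle_def carrier_picket_sum_group[OF p] by auto
  next
    fix y assume y: "y \<in> coord_socle p I n (Q - R)"
    then have yi: "y \<in> extensional I" "\<And>i. i \<in> I \<Longrightarrow> i \<notin> Q - R \<Longrightarrow> y i = 0"
      by (auto simp: coord_socle_def carrier_picket_sum_group[OF p])
    then have "y = ?r y" by (intro extensionalityI[of _ I]) auto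
    moreover have "y \<in> coord_socle p I n Q" using y by (auto simp: coord_socle_def)
    ultimately show "y \<in> ?r ` coord_socle p I n Q" by (rule image_eqI)
  qed
  then show "(?r \<circ> f) ` A = coord_socle p I n (Q - R)"
    using A(2) by (simp only: image_comp[symmetric])
  fix x y assume xy: "x \<in> A" "y \<in> A"
  then have xyG: "x \<in> carrier G" "y \<in> carrier G" using A by auto
  have fxy: "f x \<in> coord_socle p I n Q" "f y \<in> coord_socle p I n Q" using xy A by auto
  have d: "int (p ^ (n i - 1)) dvd int (p ^ n i)" for i
    by (simp add: le_imp_power_dvd)
  define z where "z = f x \<otimes>\<^bsub>?P\<^esub> inv\<^bsub>?P\<^esub> f y"
  have z: "z \<in> carrier ?P" unfolding z_def using xyG by simp
  have z0: "z i = (f x i - f y i) mod int (p ^ n i)" if "i \<in> I" for i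
    unfolding z_def using that inv_picket_sum_group[of "f y" p I n] xyG
    by (simp add: mult_picket_sum_group mod_simps)
  have zi: "z i = 0 \<longleftrightarrow> f x i = f y i" "int (p ^ (n i - 1)) dvd z i" if i: "i \<in> I" for i
  proof -
    have b: "0 \<le> f x i" "f x i < int (p ^ n i)" "0 \<le> f y i" "f y i < int (p ^ n i)"
      using fxy i by (auto simp: coord_socle_def carrier_picket_sum_group[OF p])
    have "z i = 0 \<longleftrightarrow> f x i mod int (p ^ n i) = f y i mod int (p ^ n i)"
      unfolding z0[OF i] by (simp only: mod_eq_dvd_iff mod_eq_0_iff_dvd)
    then show "z i = 0 \<longleftrightarrow> f x i = f y i" using b by simp
    show "int (p ^ (n i - 1)) dvd z i"
      unfolding z0[OF i] using fxy i d by (auto simp: coord_socle_def intro!: dvd_mod dvd_diff)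
  qed
  have xyi: "x \<otimes>\<^bsub>G\<^esub> inv\<^bsub>G\<^esub> y \<in> carrier G" using xyG by simp
  have "x \<otimes>\<^bsub>G\<^esub> inv\<^bsub>G\<^esub> y \<in> K \<longleftrightarrow> f (x \<otimes>\<^bsub>G\<^esub> inv\<^bsub>G\<^esub> y) \<in> f ` K"
    by (rule inj_on_image_mem_iff[OF inj xyi K(1), symmetric])
  also have "f (x \<otimes>\<^bsub>G\<^esub> inv\<^bsub>G\<^esub> y) = z" unfolding z_def using xyG by simp
  also have "z \<in> f ` K \<longleftrightarrow> (\<forall>i\<in>I. i \<notin> R \<longrightarrow> f x i = f y i)"
    unfolding K(2) using z zi by (auto simp: coord_socle_def)
  also have "\<dots> \<longleftrightarrow> (?r \<circ> f) x = (?r \<circ> f) y"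
  proof -
    have "f x i = 0" "f y i = 0" if "i \<in> I" "i \<notin> Q" for i
      using fxy that by (simp_all add: coord_socle_def)
    then have "(if i \<in> Q - R then f x i else 0) = (if i \<in> Q - R then f y i else 0) \<longleftrightarrow>
        (i \<notin> R \<longrightarrow> f x i = f y i)" if "i \<in> I" for i
      using that by auto
    then show ?thesis by (auto simp: fun_eq_iff)
  qed
  finally show "((?r \<circ> f) x = (?r \<circ> f) y) = (x \<otimes>\<^bsub>G\<^esub> inv\<^bsub>G\<^esub> y \<in> K)" by simp
qed

section \<open>Invariants of the pair and comparison of two decompositions\<close>

lemma eqpoll_image_same_kernel:
  assumes "\<And>x y. x \<in> A \<Longrightarrow> y \<in> A \<Longrightarrow> f x = f y \<longleftrightarrow> g x = g y"
  shows "f ` A \<approx> g ` A"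
proof -
  let ?h = "\<lambda>z. g (inv_into A f z)"
  have h: "?h (f x) = g x" if "x \<in> A" for x
    using assms[of "inv_into A f (f x)" x] that by (simp add: inv_into_into f_inv_into_f)
  have "inj_on ?h (f ` A)" using h assms by (auto simp: inj_on_def)
  moreover have "?h ` f ` A = g ` A" using h by (auto simp: image_image)
  ultimately show ?thesis unfolding eqpoll_def bij_betw_def by blast
qed

text \<open>For \<open>b\<close> true resp. false, these two subgroups have as quotient an elementary abelian group whose
  rank is the number of summands \<open>P\<^sup>n\<^sub>1\<close> resp. \<open>P\<^sup>n\<^sub>0\<close> with \<open>n = a + 1\<close>.\<close>

definition invariant_top :: "nat \<Rightarrow> ('a,'b) monoid_scheme \<Rightarrow> 'a set \<Rightarrow> nat \<Rightarrow> bool \<Rightarrow> 'a set"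
  where "invariant_top p G U a b = (if b then U \<inter> height_socle p G a else height_socle p G a)"

definition invariant_bot :: "nat \<Rightarrow> ('a,'b) monoid_scheme \<Rightarrow> 'a set \<Rightarrow> nat \<Rightarrow> bool \<Rightarrow> 'a set"
  where "invariant_bot p G U a b = (if b then U \<inter> height_socle p G (Suc a)
     else height_socle p G (Suc a) <#>\<^bsub>G\<^esub> (U \<inter> height_socle p G a))"

text \<open>Under the isomorphism both groups become coordinate socles, over index sets
  \<open>Q\<close> and \<open>R\<close>. Since \<open>a < n i\<close> without
  \<open>Suc a < n i\<close> means \<open>n i = Suc a\<close>, the difference \<open>Q - R\<close>
  isolates one kind of picket.\<close>

lemma invariant_surjection:
  assumes p0: "p > 0" and grp: "group G" and U: "U \<subseteq> carrier G"
    and n: "\<And>i. i \<in> I \<Longrightarrow> n i \<ge> 1"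
    and I: "pair_iso G U (picket_sum_group p I n) (picket_sum_sub p I n t)"
  shows "\<exists>\<rho>. \<rho> ` invariant_top p G U a b = coord_socle p I n {i\<in>I. n i = Suc a \<and> t i = b} \<and>
      (\<forall>x\<in>invariant_top p G U a b. \<forall>y\<in>invariant_top p G U a b.
        \<rho> x = \<rho> y \<longleftrightarrow> x \<otimes>\<^bsub>G\<^esub> inv\<^bsub>G\<^esub> y \<in> invariant_bot p G U a b)"
proof -
  let ?P = "picket_sum_group p I n"
  have sG: "height_socle p G e \<subseteq> carrier G" for e by (auto simp: height_socle_def)
  have UsG: "U \<inter> height_socle p G e \<subseteq> carrier G" for e using U by blast
  have top: "invariant_top p G U a b \<subseteq> carrier G"
    using sG U by (auto simp: invariant_top_def)
  have bot: "invariant_bot p G U a b \<subseteq> carrier G"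
    using monoid.set_mult_closed[OF group.is_monoid[OF grp] sG UsG] UsG by (auto simp: invariant_bot_def)
  obtain f where f: "f \<in> iso G ?P" "f ` U = picket_sum_sub p I n t"
    using I by (auto simp: pair_iso_def)
  have fU: "f ` U = coord_socle p I n {i. t i}"
    using f(2) picket_sum_sub_eq_coord_socle[of p I n t] p0 n by simp
  have fs: "f ` height_socle p G e = coord_socle p I n {i. e < n i}" for e
    using iso_height_socle[OF grp group_picket_sum_group f(1)]
      height_socle_picket_sum_group[OF p0, of I n] n by simp
  have inj: "inj_on f (carrier G)" and hom: "f \<in> hom G ?P" using f(1) by (auto simp: iso_def bij_betw_def)
  have fUs: "f ` (U \<inter> height_socle p G e) = coord_socle p I n ({i. t i} \<inter> {i. e < n i})" for e
    using inj_on_image_Int[OF inj U sG] fU fs by (simp only: coord_socle_Int)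
  define Q where "Q = (if b then {i. t i} \<inter> {i. a < n i} else {i. a < n i})"
  define R where "R = (if b then {i. t i} \<inter> {i. Suc a < n i}
    else {i. Suc a < n i} \<union> ({i. t i} \<inter> {i. a < n i}))"
  have ftop: "f ` invariant_top p G U a b = coord_socle p I n Q"
    using fs[of a] fUs[of a] unfolding invariant_top_def Q_def by (cases b) simp_all
  have fbot: "f ` invariant_bot p G U a b = coord_socle p I n R"
  proof (cases b)
    case True
    then show ?thesis using fUs[of "Suc a"] unfolding invariant_bot_def R_def by simp
  next
    case False
    with set_mult_hom[OF hom sG UsG] show ?thesis
      unfolding invariant_bot_def R_def by (simp only: if_False fs fUs coord_socle_set_mult[OF p0])
  qed
  have "i \<in> Q - R \<longleftrightarrow> n i = Suc a \<and> t i = b" for i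
    unfolding Q_def R_def by auto
  then have "coord_socle p I n (Q - R) = coord_socle p I n {i\<in>I. n i = Suc a \<and> t i = b}"
    unfolding coord_socle_def by (intro Collect_cong) auto
  with coset_surjection_coord_socle[OF p0 grp f(1) top ftop bot fbot] show ?thesis by simp
qed

text \<open>The two invariant groups depend only on \<open>G\<close> and \<open>U\<close>, so the
  surjections from the two decompositions have the same fibres and hence equipotent images.\<close>

lemma picket_classes_eqpoll:
  assumes p: "p > 1" and grp: "group G" and U: "U \<subseteq> carrier G"
    and n: "\<And>i. i \<in> I \<Longrightarrow> n i \<ge> 1" and m: "\<And>j. j \<in> J \<Longrightarrow> m j \<ge> 1"
    and I: "pair_iso G U (picket_sum_group p I n) (picket_sum_sub p I n t)"
    and J: "pair_iso G U (picket_sum_group p J m) (picket_sum_sub p J m s)"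
  shows "{i\<in>I. n i = l \<and> t i = b} \<approx> {j\<in>J. m j = l \<and> s j = b}"
proof (cases l)
  case (Suc a)
  let ?V = "invariant_top p G U a b" and ?K = "invariant_bot p G U a b"
  have p0: "p > 0" using p by simp
  obtain \<rho> where \<rho>: "\<rho> ` ?V = coord_socle p I n {i\<in>I. n i = Suc a \<and> t i = b}"
    "\<forall>x\<in>?V. \<forall>y\<in>?V. \<rho> x = \<rho> y \<longleftrightarrow> x \<otimes>\<^bsub>G\<^esub> inv\<^bsub>G\<^esub> y \<in> ?K"
    using invariant_surjection[OF p0 grp U n I, of a b] by blast
  obtain \<rho>' where \<rho>': "\<rho>' ` ?V = coord_socle p J m {j\<in>J. m j = Suc a \<and> s j = b}"
    "\<forall>x\<in>?V. \<forall>y\<in>?V. \<rho>' x = \<rho>' y \<longleftrightarrow> x \<otimes>\<^bsub>G\<^esub> inv\<^bsub>G\<^esub> y \<in> ?K"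
    using invariant_surjection[OF p0 grp U m J, of a b] by blast
  have "\<rho> ` ?V \<approx> \<rho>' ` ?V" using \<rho>(2) \<rho>'(2) by (intro eqpoll_image_same_kernel) simp
  then have eq: "coord_socle p I n {i\<in>I. n i = Suc a \<and> t i = b} \<approx>
      coord_socle p J m {j\<in>J. m j = Suc a \<and> s j = b}"
    by (simp only: \<rho>(1) \<rho>'(1))
  show ?thesis
    unfolding Suc by (rule coord_socle_eqpoll_imp_eqpoll[OF p n _ m _ eq]) auto
next
  case 0
  then have empty: "{i\<in>I. n i = l \<and> t i = b} = {}" "{j\<in>J. m j = l \<and> s j = b} = {}"
    using n m by fastforce+
  show ?thesis unfolding empty by simp
qed

text \<open>The chosen bijections between fibres glue together because distinct fibres are
  disjoint.\<close>

lemma bij_betw_of_fibres: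
  assumes "\<And>k. {i\<in>I. f i = k} \<approx> {j\<in>J. g j = k}"
  shows "\<exists>\<sigma>. bij_betw \<sigma> I J \<and> (\<forall>i\<in>I. g (\<sigma> i) = f i)"
proof -
  obtain h where h: "\<And>k. bij_betw (h k) {i\<in>I. f i = k} {j\<in>J. g j = k}"
    using assms unfolding eqpoll_def by metis
  let ?\<sigma> = "\<lambda>i. h (f i) i"
  have \<sigma>: "?\<sigma> i \<in> J \<and> g (?\<sigma> i) = f i" if "i \<in> I" for i
    using bij_betwE[OF h[of "f i"]] that by blast
  have "inj_on ?\<sigma> I"
  proof (rule inj_onI)
    fix a b assume ab: "a \<in> I" "b \<in> I" "?\<sigma> a = ?\<sigma> b"
    then have "f a = f b" using \<sigma> by metis
    then show "a = b" using ab h[of "f a"] by (auto simp: bij_betw_def inj_on_def)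
  qed
  moreover have "j \<in> ?\<sigma> ` I" if "j \<in> J" for j
  proof -
    have "j \<in> h (g j) ` {i\<in>I. f i = g j}" using h[of "g j"] that by (auto simp: bij_betw_def)
    then obtain i where "i \<in> I" "f i = g j" "j = h (g j) i" by blast
    then show ?thesis by (intro image_eqI[of _ _ i]) simp_all
  qed
  ultimately have "bij_betw ?\<sigma> I J" using \<sigma> by (auto simp: bij_betw_def)
  with \<sigma> show ?thesis by blast
qed

lemma pair_iso_refl: "pair_iso G U G U"
  using iso_set_refl by (force simp: pair_iso_def)

theorem theorem2:
  fixes G :: "('a, 'b) monoid_scheme" and U :: "'a set" and p :: nat
  assumes "Factorial_Ring.prime p"
    and "comm_group G"
    and "dsum_cyclic_p TYPE('a) p G"
    and "subgroup U G"
    and "\<forall>u\<in>U. u [^]\<^bsub>G\<^esub> p = \<one>\<^bsub>G\<^esub>"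
  shows "((\<exists>(I::'a set) (n::'a \<Rightarrow> nat) (t::'a \<Rightarrow> bool). (\<forall>i\<in>I. n i \<ge> 1) \<and>
             pair_iso G U (picket_sum_group p I n) (picket_sum_sub p I n t))
          \<longleftrightarrow> dsum_cyclic_p TYPE('a) p (G Mod U))
    \<and> (\<forall>(I::'i set) (n::'i \<Rightarrow> nat) (t::'i \<Rightarrow> bool) (J::'j set) (m::'j \<Rightarrow> nat) (s::'j \<Rightarrow> bool).
          (\<forall>i\<in>I. n i \<ge> 1) \<and> (\<forall>j\<in>J. m j \<ge> 1)
          \<and> pair_iso G U (picket_sum_group p I n) (picket_sum_sub p I n t)
          \<and> pair_iso G U (picket_sum_group p J m) (picket_sum_sub p J m s)
          \<longrightarrow> (\<exists>\<sigma>. bij_betw \<sigma> I J \<and>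
                 (\<forall>i\<in>I. pair_iso (integer_mod_group (p ^ n i)) (picket_sub p (n i) (t i))
                           (integer_mod_group (p ^ m (\<sigma> i))) (picket_sub p (m (\<sigma> i)) (s (\<sigma> i))))))"
proof (intro conjI iffI allI impI)
  interpret comm_group G by fact
  have p1: "p > 1" and p0: "p > 0" using prime_gt_1_nat[OF assms(1)] by auto
  have UG: "U \<subseteq> carrier G" using subgroup.subset[OF assms(4)] .
  {
    assume "\<exists>(I::'a set) (n::'a \<Rightarrow> nat) (t::'a \<Rightarrow> bool). (\<forall>i\<in>I. n i \<ge> 1) \<and>
      pair_iso G U (picket_sum_group p I n) (picket_sum_sub p I n t)"
    then obtain I :: "'a set" and n t where n: "\<And>i. i \<in> I \<Longrightarrow> n i \<ge> 1"
      and iso: "pair_iso G U (picket_sum_group p I n) (picket_sum_sub p I n t)" by blast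
    show "dsum_cyclic_p TYPE('a) p (G Mod U)"
      by (rule dsum_cyclic_p_quotient[OF p0 group_axioms UG n iso])
  next
    assume quot: "dsum_cyclic_p TYPE('a) p (G Mod U)"
    interpret U: normal U G using normal_iff_subgroup assms(4) by simp
    have "group_hom G G (\<lambda>x. x)"
      by (auto intro!: group_hom.intro group_hom_axioms.intro homI)
    moreover have "kernel G G (\<lambda>x. x) = {\<one>\<^bsub>G\<^esub>}" by (auto simp: kernel_def)
    ultimately obtain F where F: "height_chain p G {\<one>\<^bsub>G\<^esub>} F"
      using dsum_cyclic_p_height_chain[OF p0 _ assms(3), of G "\<lambda>x. x"] by auto
    have hom: "group_hom G (G Mod U) (\<lambda>a. U #>\<^bsub>G\<^esub> a)"
      by (intro group_hom.intro group_hom_axioms.intro group_axioms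
          U.factorgroup_is_group U.r_coset_hom_Mod)
    have "kernel G (G Mod U) (\<lambda>a. U #>\<^bsub>G\<^esub> a) = U"
      using UG coset_join1[OF _ _ assms(4)] coset_join2[OF _ assms(4)] by (auto simp: kernel_def FactGroup_def)
    then obtain F' where F': "height_chain p G U F'"
      using dsum_cyclic_p_height_chain[OF p0 hom quot] by auto
    interpret height_chain_pair G p U F F'
      by (intro height_chain_pair.intro height_chain_pair_axioms.intro) (use assms F F' in \<open>blast+\<close>)
    show "\<exists>(I::'a set) (n::'a \<Rightarrow> nat) (t::'a \<Rightarrow> bool). (\<forall>i\<in>I. n i \<ge> 1) \<and>
        pair_iso G U (picket_sum_group p I n) (picket_sum_sub p I n t)"
      \<comment> \<open>The summands are indexed by the basis, a subset of \<open>G\<close>, so the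
        index type is that of \<open>G\<close>.\<close>
      by (rule exI, rule exI, rule exI, rule conjI[OF _ pair_iso_picket_sum]) simp
  next
    fix I :: "'i set" and n t and J :: "'j set" and m s
    assume *: "(\<forall>i\<in>I. n i \<ge> 1) \<and> (\<forall>j\<in>J. m j \<ge> 1)
          \<and> pair_iso G U (picket_sum_group p I n) (picket_sum_sub p I n t)
          \<and> pair_iso G U (picket_sum_group p J m) (picket_sum_sub p J m s)"
    \<comment> \<open>Matching exponent and type simultaneously makes corresponding pickets equal,
      so the identity is the required isomorphism.\<close>
    have "{i\<in>I. (n i, t i) = k} \<approx> {j\<in>J. (m j, s j) = k}" for k
      using picket_classes_eqpoll[OF p1 group_axioms UG, of I n J m t s "fst k" "snd k"] *
      by (simp add: prod_eq_iff)
    from bij_betw_of_fibres[OF this] obtain \<sigma> where \<sigma>: "bij_betw \<sigma> I J"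
      "\<forall>i\<in>I. (m (\<sigma> i), s (\<sigma> i)) = (n i, t i)" by blast
    then show "\<exists>\<sigma>. bij_betw \<sigma> I J \<and>
        (\<forall>i\<in>I. pair_iso (integer_mod_group (p ^ n i)) (picket_sub p (n i) (t i))
          (integer_mod_group (p ^ m (\<sigma> i))) (picket_sub p (m (\<sigma> i)) (s (\<sigma> i))))"
      by (intro exI[of _ \<sigma>]) (simp add: pair_iso_refl)
  }
qed

end
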